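(* Let $d\ge2$ and let $\mathcal M_E(\Sigma_d)=\mathcal T_E(\Sigma_d)/\sim$ be the moduli space of essentially affine iterated function systems on $\Sigma_d$. Call $\Phi,\Psi\in\mathcal M_E(\Sigma_d)$ Lyapunov-related if there exist $u,v\in\mathbb R\setminus\{0\}$ with $\mu_{\Phi,u}\cong\mu_{\Psi,v}$. (i) Being Lyapunov-related is an equivalence relation on $\mathcal M_E(\Sigma_d)$. (ii) Let $\Phi\in\mathcal M_E(\Sigma_d)$ have contraction rate vector $(\lambda_1,\dots,\lambda_d)$, and let $[[\Phi]]$ be the equivalence class of $\Phi$ modulo the Lyapunov-relation. For $\Psi\in\mathcal M_E(\Sigma_d)$ let $(\rho_1,\dots,\rho_d)$ denote its contraction rate vector. If $\Phi$ is degenerate, then $$[[\Phi]]=\{\Psi\in\mathcal M_E(\Sigma_d):\ \rho_i=t\ \text{for all } i\in I,\ \text{for some } t\in(0,1/d]\}.$$ If $\Phi$ is non-degenerate, then $$[[\Phi]]=\{\Psi\in\mathcal M_E(\Sigma_d):\ \rho_i=t\cdot\lambda_i^{s}\ \text{for all } i\in I,\ \text{for some } s,t\in\mathbb R\setminus\{0\}\}.$$ (Contraction rate vectors are defined up to permutation of their entries; the conditions are understood to hold for a suitable ordering of the entries of $(\rho_1,\dots,\rho_d)$.)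
   Context: Let $I=\{1,\dots,d\}$, $d\ge2$, $\Sigma_d=I^{\mathbb N}$ with left shift $\sigma$, $[x_1\dots x_n]$ the cylinder of all $y\in\Sigma_d$ with $y_i=x_i$ for $i\le n$, and $S_nf=\sum_{k=0}^{n-1}f\circ\sigma^k$. Conformal iterated function system (CS). An ordered family $\Phi=(\phi_i:X\to\operatorname{Int}X\mid i\in I)$ of injective contractions of a connected compact set (interval) $X\subset\mathbb R$, such that, writing $\phi_\omega=\phi_{x_1}\circ\dots\circ\phi_{x_n}$ for $\omega=x_1\dots x_n\in I^n$: - (open set condition) $\phi_i(\operatorname{Int}X)\subset\operatorname{Int}X$ for all $i$, and $\phi_i(\operatorname{Int}X)\cap\phi_j(\operatorname{Int}X)=\emptyset$ for $i\ne j$; - (conformality) there is an open connected set $U\subset\mathbb C$ containing $X$ such that each $\phi_i$ extends to a conformal map on $U$ (into $U$, so that the $\phi_\omega$ are defined on $U$); - (bounded distortion) there is $C\ge1$ with $|\phi_\omega'(y)|\le C|\phi_\omega'(x)|$ for all $n\in\mathbb N$, $\omega\in I^n$, $x,y\in U$. The limit set is $\Lambda(\Phi)=\bigcap_n\bigcup_{\omega\in I^n}\phi_\omega(X)$, and $\pi_\Phi:\Sigma_d\to\Lambda(\Phi)$, $\pi_\Phi(x_1x_2\dots)=\lim_n\phi_{x_1\dots x_n}(X)$, is the canonical bijection. $\mathcal T(\Sigma_d)$ is the set of all CS with index set $I$. A CS is an affine system (AS) if all $\phi_i$ are affine. A CS $\Psi$ is an essentially affine system (EAS) if there are an AS $\Phi$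 and a bi-Lipschitz bijection $h:\Lambda(\Phi)\to\Lambda(\Psi)$ with $\psi_i=h\circ\phi_i\circ h^{-1}$ on $\Lambda(\Psi)$ for all $i\in I$. $\mathcal T_E(\Sigma_d)$ is the set of all EAS in $\mathcal T(\Sigma_d)$. For $\Phi,\Psi\in\mathcal T(\Sigma_d)$, $\Phi\sim\Psi$ means that, for some system $\Psi_0=(\psi_{\tau(1)},\dots,\psi_{\tau(d)})=:(\psi^0_1,\dots,\psi^0_d)$ obtained from $\Psi$ by a permutation $\tau$ of the generators, there is a bi-Lipschitz bijection $h:\Lambda(\Phi)\to\Lambda(\Psi)$ with $\psi^0_i\circ h=h\circ\phi_i$ on $\Lambda(\Phi)$ for all $i\in I$. A CS is degenerate if it is equivalent (under $\sim$) to an AS $(\psi_i)_{i\in I}$ with $\psi_i'=\psi_j'$ for all $i,j\in I$. Each element of $\mathcal M_E(\Sigma_d)$ is represented by an affine system $(\phi_i)_{i\in I}$ contained in it; its contraction rate vector is $(|\phi_1'|,\dots,|\phi_d'|)$, which depends only on the class up to permutation of the entries. The canonical geometric potential is $I_\Phi:\Sigma_d\to\mathbb R$, $I_\Phi(x)=\log|\phi_{x_1}'(\pi_\Phi(\sigma x))|$ (so $I_\Phi(x)=\log|\phi_{x_1}'|$ for an AS). The pressure of $f:\Sigma_d\to\mathbb R$ is $\mathcal P(f)=\lim_n\frac1n\log\sum_{\omega\in I^n}\exp(\sup_{x\in[\omega]}S_nf(x))$, and $P_\Phi(u):=\mathcal P(u I_\Phi)$ for $u\in\mathbb R$. $\mu_{\Phi,u}$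 is the $\sigma$-invariant Gibbs probability measure on $\Sigma_d$ for $uI_\Phi-P_\Phi(u)$, i.e. the $\sigma$-invariant probability measure with $\mu_{\Phi,u}([x_1\dots x_n])\asymp e^{uS_nI_\Phi(x)-nP_\Phi(u)}$ uniformly in $n$, $(x_1,\dots,x_n)\in I^n$ and $x\in[x_1\dots x_n]$. $\mu_{\Phi,u}\cong\mu_{\Psi,v}$ means $\mu_{\Phi,u}=\mu_{\Psi_0,v}$ for some system $\Psi_0$ obtained from $\Psi$ by a permutation of its generators. *)

theory Defs
  imports
    "HOL-Complex_Analysis.Complex_Analysis"
    "HOL-Probability.Probability"
    "HOL-Combinatorics.Combinatorics"
begin

section \<open>Conformal iterated function systems\<close>

text \<open>
  The index set is \<open>I = {1..d}\<close>. A system consists of the interval \<open>X\<close> (\<open>base\<close>) and the maps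
  \<open>\<phi>\<^sub>i\<close> (\<open>gen\<close>). Values of \<open>gen \<Phi> i\<close> for \<open>i \<notin> I\<close> or outside \<open>X\<close> are irrelevant junk: no notion
  below depends on them.
\<close>

datatype ifs = IFS (base: "real set") (gen: "nat \<Rightarrow> real \<Rightarrow> real")

definition words :: "nat \<Rightarrow> nat \<Rightarrow> nat list set" where
  "words d n = {w. set w \<subseteq> {1..d} \<and> length w = n}"

definition comp_word :: "(nat \<Rightarrow> 'a \<Rightarrow> 'a) \<Rightarrow> nat list \<Rightarrow> 'a \<Rightarrow> 'a" where
  "comp_word f w = foldr (\<circ>) (map f w) id"

text \<open>
  A conformal map on \<open>U\<close> is an injective holomorphic one (so its derivative vanishes nowhere).
  The extensions \<open>f i\<close> map \<open>U\<close> into itself, and the distortion bound is required on the same \<open>U\<close>.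
\<close>

definition conformal_ext :: "nat \<Rightarrow> ifs \<Rightarrow> complex set \<Rightarrow> (nat \<Rightarrow> complex \<Rightarrow> complex) \<Rightarrow> bool" where
  "conformal_ext d \<Phi> U f \<longleftrightarrow>
     open U \<and> connected U \<and> complex_of_real ` base \<Phi> \<subseteq> U \<and>
     (\<forall>i\<in>{1..d}. f i holomorphic_on U \<and> inj_on (f i) U \<and> f i ` U \<subseteq> U \<and>
        (\<forall>x\<in>base \<Phi>. f i (complex_of_real x) = complex_of_real (gen \<Phi> i x)))"

definition bounded_distortion :: "nat \<Rightarrow> complex set \<Rightarrow> (nat \<Rightarrow> complex \<Rightarrow> complex) \<Rightarrow> bool" where
  "bounded_distortion d U f \<longleftrightarrow>
     (\<exists>C\<ge>1. \<forall>n. \<forall>w\<in>words d n. \<forall>x\<in>U. \<forall>y\<in>U.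
        cmod (deriv (comp_word f w) y) \<le> C * cmod (deriv (comp_word f w) x))"

definition CS :: "nat \<Rightarrow> ifs \<Rightarrow> bool" where
  "CS d \<Phi> \<longleftrightarrow>
     base \<Phi> \<noteq> {} \<and> compact (base \<Phi>) \<and> connected (base \<Phi>) \<and>
     (\<forall>i\<in>{1..d}. gen \<Phi> i ` base \<Phi> \<subseteq> interior (base \<Phi>) \<and> inj_on (gen \<Phi> i) (base \<Phi>) \<and>
        (\<exists>c<1. c-lipschitz_on (base \<Phi>) (gen \<Phi> i))) \<and>
     (\<forall>i\<in>{1..d}. gen \<Phi> i ` interior (base \<Phi>) \<subseteq> interior (base \<Phi>)) \<and>
     (\<forall>i\<in>{1..d}. \<forall>j\<in>{1..d}. i \<noteq> j \<longrightarrow>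
        gen \<Phi> i ` interior (base \<Phi>) \<inter> gen \<Phi> j ` interior (base \<Phi>) = {}) \<and>
     (\<exists>U f. conformal_ext d \<Phi> U f \<and> bounded_distortion d U f)"

definition limit_set :: "nat \<Rightarrow> ifs \<Rightarrow> real set" where
  "limit_set d \<Phi> = (\<Inter>n. \<Union>w\<in>words d n. comp_word (gen \<Phi>) w ` base \<Phi>)"

text \<open>
  Points of \<open>\<Sigma>\<^sub>d\<close> are elements of \<^term>\<open>streams {1..d}\<close>; the shift is \<^term>\<open>stl\<close> and the cylinder of
  a word \<open>w\<close> is \<^term>\<open>sstart {1..d} w\<close>. The sets \<open>\<phi>\<^sub>x\<^sub>1\<^sub>.\<^sub>.\<^sub>.\<^sub>x\<^sub>n(X)\<close> are nested compact with diameters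
  tending to \<open>0\<close>; their limit is the unique point of their intersection.
\<close>

definition coding :: "ifs \<Rightarrow> nat stream \<Rightarrow> real" where
  "coding \<Phi> x = the_elem (\<Inter>n. comp_word (gen \<Phi>) (stake n x) ` base \<Phi>)"

definition bi_lipschitz_bij :: "(real \<Rightarrow> real) \<Rightarrow> real set \<Rightarrow> real set \<Rightarrow> bool" where
  "bi_lipschitz_bij h A B \<longleftrightarrow> bij_betw h A B \<and>
     (\<exists>L. L-lipschitz_on A h) \<and> (\<exists>L. L-lipschitz_on B (inv_into A h))"

definition AS :: "nat \<Rightarrow> ifs \<Rightarrow> bool" where
  "AS d \<Phi> \<longleftrightarrow> CS d \<Phi> \<and> (\<forall>i\<in>{1..d}. \<exists>a b. \<forall>x\<in>base \<Phi>. gen \<Phi> i x = a * x + b)"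

definition EAS :: "nat \<Rightarrow> ifs \<Rightarrow> bool" where
  "EAS d \<Psi> \<longleftrightarrow> CS d \<Psi> \<and>
     (\<exists>\<Phi> h. AS d \<Phi> \<and> bi_lipschitz_bij h (limit_set d \<Phi>) (limit_set d \<Psi>) \<and>
        (\<forall>i\<in>{1..d}. \<forall>y\<in>limit_set d \<Psi>.
           gen \<Psi> i y = h (gen \<Phi> i (inv_into (limit_set d \<Phi>) h y))))"

definition permute_gens :: "(nat \<Rightarrow> nat) \<Rightarrow> ifs \<Rightarrow> ifs" where
  "permute_gens \<tau> \<Psi> = IFS (base \<Psi>) (\<lambda>i. gen \<Psi> (\<tau> i))"

definition sim :: "nat \<Rightarrow> ifs \<Rightarrow> ifs \<Rightarrow> bool" where
  "sim d \<Phi> \<Psi> \<longleftrightarrow>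
     (\<exists>\<tau> h. \<tau> permutes {1..d} \<and> bi_lipschitz_bij h (limit_set d \<Phi>) (limit_set d \<Psi>) \<and>
        (\<forall>i\<in>{1..d}. \<forall>x\<in>limit_set d \<Phi>. gen (permute_gens \<tau> \<Psi>) i (h x) = h (gen \<Phi> i x)))"

text \<open>Limit sets lie in the interior of the base, so derivatives are only taken there.\<close>

definition degenerate :: "nat \<Rightarrow> ifs \<Rightarrow> bool" where
  "degenerate d \<Phi> \<longleftrightarrow>
     (\<exists>\<Psi>. AS d \<Psi> \<and> sim d \<Phi> \<Psi> \<and>
        (\<forall>i\<in>{1..d}. \<forall>j\<in>{1..d}. \<forall>x\<in>interior (base \<Psi>). deriv (gen \<Psi> i) x = deriv (gen \<Psi> j) x))"

section \<open>Gibbs measures of the geometric potential\<close>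

definition birkhoff_sum :: "nat \<Rightarrow> (nat stream \<Rightarrow> real) \<Rightarrow> nat stream \<Rightarrow> real" where
  "birkhoff_sum n f x = (\<Sum>k<n. f (sdrop k x))"

definition geom_potential :: "ifs \<Rightarrow> nat stream \<Rightarrow> real" where
  "geom_potential \<Phi> x = ln \<bar>deriv (gen \<Phi> (shd x)) (coding \<Phi> (stl x))\<bar>"

definition pressure :: "nat \<Rightarrow> (nat stream \<Rightarrow> real) \<Rightarrow> real" where
  "pressure d f =
     lim (\<lambda>n. ln (\<Sum>w\<in>words d n. exp (SUP x\<in>sstart {1..d} w. birkhoff_sum n f x)) / real n)"

definition geom_pressure :: "nat \<Rightarrow> ifs \<Rightarrow> real \<Rightarrow> real" where
  "geom_pressure d \<Phi> u = pressure d (\<lambda>x. u * geom_potential \<Phi> x)"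

definition invariant_gibbs :: "nat \<Rightarrow> ifs \<Rightarrow> real \<Rightarrow> nat stream measure \<Rightarrow> bool" where
  "invariant_gibbs d \<Phi> u \<mu> \<longleftrightarrow>
     prob_space \<mu> \<and> sets \<mu> = sets (stream_space (count_space {1..d})) \<and>
     distr \<mu> \<mu> stl = \<mu> \<and>
     (\<exists>C\<ge>1. \<forall>n. \<forall>w\<in>words d n. \<forall>x\<in>sstart {1..d} w.
        (let g = exp (u * birkhoff_sum n (geom_potential \<Phi>) x - real n * geom_pressure d \<Phi> u)
         in g / C \<le> measure \<mu> (sstart {1..d} w) \<and> measure \<mu> (sstart {1..d} w) \<le> C * g))"

definition gibbs_measure :: "nat \<Rightarrow> ifs \<Rightarrow> real \<Rightarrow> nat stream measure" where
  "gibbs_measure d \<Phi> u = (THE \<mu>. invariant_gibbs d \<Phi> u \<mu>)"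

definition gibbs_cong :: "nat \<Rightarrow> ifs \<Rightarrow> real \<Rightarrow> ifs \<Rightarrow> real \<Rightarrow> bool" where
  "gibbs_cong d \<Phi> u \<Psi> v \<longleftrightarrow>
     (\<exists>\<tau>. \<tau> permutes {1..d} \<and> gibbs_measure d \<Phi> u = gibbs_measure d (permute_gens \<tau> \<Psi>) v)"

section \<open>The moduli space of essentially affine systems\<close>

definition moduli_E :: "nat \<Rightarrow> ifs set set" where
  "moduli_E d = {\<Phi>. EAS d \<Phi>} // {(\<Phi>, \<Psi>). EAS d \<Phi> \<and> EAS d \<Psi> \<and> sim d \<Phi> \<Psi>}"

text \<open>
  Up to permutation of the generators, the Gibbs measure and degeneracy depend only on the class;
  they are lifted to classes through an arbitrary representative.
\<close>

definition lyapunov_rel :: "nat \<Rightarrow> (ifs set \<times> ifs set) set" where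
  "lyapunov_rel d = {(A, B). A \<in> moduli_E d \<and> B \<in> moduli_E d \<and>
     (\<exists>\<Phi>\<in>A. \<exists>\<Psi>\<in>B. \<exists>u v. u \<noteq> 0 \<and> v \<noteq> 0 \<and> gibbs_cong d \<Phi> u \<Psi> v)}"

definition degenerate_class :: "nat \<Rightarrow> ifs set \<Rightarrow> bool" where
  "degenerate_class d A \<longleftrightarrow> (\<exists>\<Phi>\<in>A. degenerate d \<Phi>)"

text \<open>
  \<open>r 1, \<dots>, r d\<close> is the contraction rate vector of the class, in one of its orderings: every
  ordering arises, since a class is closed under permuting the generators of its members.
\<close>

definition contraction_rates :: "nat \<Rightarrow> ifs set \<Rightarrow> (nat \<Rightarrow> real) \<Rightarrow> bool" where
  "contraction_rates d A r \<longleftrightarrow>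
     (\<exists>\<Phi>\<in>A. AS d \<Phi> \<and> (\<forall>i\<in>{1..d}. \<forall>x\<in>interior (base \<Phi>). r i = \<bar>deriv (gen \<Phi> i) x\<bar>))"

end

theory Submission
  imports Defs
begin

text \<open>
  The Lyapunov relation on essentially affine systems only sees contraction rates, because their
  Gibbs measures are Bernoulli measures. Let \<open>\<Psi>\<close> be bi-Lipschitz conjugate to an affine system with
  contraction rates \<open>r\<close>, and write \<open>r\<^sub>w\<close> for the product of the rates along a word \<open>w\<close>. Distances in
  the limit set satisfy \<open>\<bar>\<psi>\<^sub>w p - \<psi>\<^sub>w q\<bar> \<asymp> r\<^sub>w \<bar>p - q\<bar>\<close>, uniformly in \<open>w\<close>, since this holds with equality
  for the affine system and is preserved by a bi-Lipschitz conjugacy. The mean value theorem and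
  bounded distortion also give \<open>\<bar>\<psi>\<^sub>w p - \<psi>\<^sub>w q\<bar> \<asymp> exp (S\<^sub>n I\<^sub>\<Psi>) \<bar>p - q\<bar>\<close> on the cylinder of \<open>w\<close>, so that the
  Birkhoff sums of the geometric potential stay within a bounded distance of \<open>ln r\<^sub>w\<close>
  (\<open>potential_near_log_weight\<close>). Hence the pressure at \<open>u\<close> is \<open>ln (\<Sum>i. r\<^sub>i powr u)\<close>, and the Gibbs bounds
  say that the measure is comparable, on cylinders, to the Bernoulli measure with weights
  \<open>r\<^sub>i powr u / (\<Sum>j. r\<^sub>j powr u)\<close>. Ergodicity of Bernoulli measures, proved here in the form of a variance
  estimate on words (\<open>invariant_word_weights_unique\<close>), turns comparability into equality
  (\<open>invariant_gibbs_iff_bernoulli\<close>).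

  Two Bernoulli measures agree only if their weights do. After reordering the generators, classes
  with rates \<open>r\<close> and \<open>\<rho>\<close> are therefore related by the parameters \<open>u\<close> and \<open>v\<close> if and only if
  \<open>\<rho>\<^sub>i powr v\<close> is proportional to \<open>r\<^sub>i powr u\<close>, that is, if \<open>\<rho>\<^sub>i = t * r\<^sub>i powr s\<close> with \<open>t > 0\<close> and
  \<open>s = u / v\<close> (\<open>lyapunov_rel_iff_rates\<close>). This condition is visibly reflexive, symmetric and
  transitive, and it is the description of the non-degenerate classes. If \<open>r\<close> is constant, the
  vectors \<open>t * r\<^sub>i powr s\<close> are all the positive constant vectors; the open set condition bounds
  the constant by \<open>1 / d\<close>, as the images of the interior of the base are disjoint subintervals of it
  (\<open>slope_sizes_sum_le_1\<close>).
\<close>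

text \<open>The index set \<open>{1..d}\<close> should not be rewritten to \<open>{Suc 0..d}\<close>.\<close>
declare One_nat_def [simp del]

section \<open>Words and weights\<close>

text \<open>
  For contraction rates \<open>r\<close> this is the size of the composition along \<open>w\<close>; for a probability vector
  it is the Bernoulli measure of the cylinder of \<open>w\<close>.
\<close>

definition weight :: "(nat \<Rightarrow> real) \<Rightarrow> nat list \<Rightarrow> real" where
  "weight p w = prod_list (map p w)"

lemma weight_simps [simp]:
  "weight p [] = 1" "weight p (a # w) = p a * weight p w" "weight p (v @ w) = weight p v * weight p w"
  by (simp_all add: weight_def)

lemma weight_pos:
  assumes "\<And>i. i \<in> {1..d} \<Longrightarrow> 0 < p i" "w \<in> words d n"
  shows "0 < weight p w"
  using assms(2) by (induction w arbitrary: n) (auto simp: words_def intro!: mult_pos_pos assms(1))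

lemma weight_cong:
  assumes "\<And>i. i \<in> {1..d} \<Longrightarrow> p i = q i" "w \<in> words d n"
  shows "weight p w = weight q w"
  using assms(2) by (induction w arbitrary: n) (auto simp: words_def assms(1))

text \<open>
  Normalising every letter by \<open>Z\<close> normalises a word of length \<open>n\<close> by \<open>Z ^ n\<close>: the weight of a word
  for the Gibbs weights is the exponential of \<open>u S\<^sub>n I - n P(u)\<close> for an affine system.
\<close>

lemma weight_normalised:
  assumes "\<And>i. i \<in> {1..d} \<Longrightarrow> 0 < r i" "w \<in> words d n"
  shows "weight (\<lambda>i. r i powr u / Z) w = weight r w powr u / Z ^ n"
  using assms(2)
proof (induction w arbitrary: n)
  case (Cons a w)
  then have aw: "a \<in> {1..d}" "w \<in> words d (length w)" "n = Suc (length w)"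
    by (auto simp: words_def)
  then show ?case
    using Cons.IH[OF aw(2)] weight_pos[OF assms(1) aw(2)] assms(1)[OF aw(1)]
    by (simp add: powr_mult)
qed (auto simp: words_def)

lemma words_0 [simp]: "words d 0 = {[]}"
  by (auto simp: words_def)

lemma finite_words [simp]: "finite (words d n)"
  unfolding words_def using finite_lists_length_eq[of "{1..d}" n] by simp

lemma words_lists: "w \<in> words d n \<Longrightarrow> w \<in> lists {1..d}"
  by (auto simp: words_def)

lemma words_length: "w \<in> words d n \<Longrightarrow> length w = n"
  by (auto simp: words_def)

lemma words_Cons [simp]: "a # w \<in> words d (Suc n) \<longleftrightarrow> a \<in> {1..d} \<and> w \<in> words d n"
  by (auto simp: words_def)

lemma words_append: "u \<in> words d m \<Longrightarrow> v \<in> words d n \<Longrightarrow> u @ v \<in> words d (m + n)"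
  by (auto simp: words_def)

lemma words_map: "\<tau> permutes {1..d} \<Longrightarrow> w \<in> words d n \<Longrightarrow> map \<tau> w \<in> words d n"
  using permutes_in_image[of \<tau> "{1..d}"] by (auto simp: words_def)

lemma sum_words_add:
  "(\<Sum>w\<in>words d (m + n). g w) = (\<Sum>u\<in>words d m. \<Sum>v\<in>words d n. g (u @ v))"
proof -
  have "(\<Sum>w\<in>words d (m + n). g w) = (\<Sum>(u, v)\<in>words d m \<times> words d n. g (u @ v))"
    by (rule sum.reindex_bij_witness[where j = "\<lambda>w. (take m w, drop m w)" and i = "\<lambda>(u, v). u @ v"])
       (auto simp: words_def dest: in_set_takeD in_set_dropD)
  then show ?thesis
    by (simp add: sum.cartesian_product)
qed

lemma sum_words_1: "(\<Sum>w\<in>words d (Suc 0). g w) = (\<Sum>i\<in>{1..d}. g [i])"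
  by (rule sum.reindex_bij_witness[where j = hd and i = "\<lambda>i. [i]"])
     (auto simp: words_def length_Suc_conv)

lemma sum_words_weight: "(\<Sum>w\<in>words d n. weight p w) = (\<Sum>i\<in>{1..d}. p i) ^ n"
proof (induction n)
  case (Suc n)
  then show ?case
    using sum_words_add[of "weight p" d "Suc 0" n]
    by (simp add: sum_words_1 sum_distrib_left[symmetric] sum_distrib_right[symmetric])
qed simp



section \<open>Bernoulli measures are the only invariant measures comparable to them\<close>

lemma weighted_variance:
  fixes x \<alpha> :: "'a \<Rightarrow> real"
  assumes "finite S" "(\<Sum>s\<in>S. \<alpha> s) = 1" "(\<Sum>s\<in>S. \<alpha> s * x s) = c"
  shows "(\<Sum>s\<in>S. \<alpha> s * (x s - c)\<^sup>2) = (\<Sum>s\<in>S. \<alpha> s * (x s)\<^sup>2) - c\<^sup>2"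
proof -
  have "(\<Sum>s\<in>S. \<alpha> s * (x s - c)\<^sup>2) = (\<Sum>s\<in>S. \<alpha> s * (x s)\<^sup>2 - 2 * c * (\<alpha> s * x s) + c\<^sup>2 * \<alpha> s)"
    by (intro sum.cong) (auto simp: power2_eq_square algebra_simps)
  also have "\<dots> = (\<Sum>s\<in>S. \<alpha> s * (x s)\<^sup>2) - 2 * c * c + c\<^sup>2"
    using assms(2,3) by (simp add: sum.distrib sum_subtractf sum_distrib_left[symmetric])
  finally show ?thesis
    by (simp add: power2_eq_square)
qed

lemma weighted_jensen_square:
  fixes x \<alpha> :: "'a \<Rightarrow> real"
  assumes "finite S" "(\<Sum>s\<in>S. \<alpha> s) = 1" "\<And>s. s \<in> S \<Longrightarrow> 0 \<le> \<alpha> s"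
  shows "(\<Sum>s\<in>S. \<alpha> s * x s)\<^sup>2 \<le> (\<Sum>s\<in>S. \<alpha> s * (x s)\<^sup>2)"
  using weighted_variance[OF assms(1,2) refl, of x]
    sum_nonneg[of S "\<lambda>s. \<alpha> s * (x s - (\<Sum>s\<in>S. \<alpha> s * x s))\<^sup>2"] assms(3)
  by simp

text \<open>
  Let \<open>f w = m w / weight p w\<close> be the density of \<open>m\<close> on the cylinder of \<open>w\<close>, and let \<open>E n\<close> be its second
  moment over words of length \<open>n\<close>. Invariance under the shift (\<open>prep\<close>) says that \<open>f w\<close> is the mean of
  \<open>f (v @ w)\<close> over the words \<open>v\<close> of length \<open>k\<close>, so \<open>E (k + n) - E n\<close> is the mean of the squared deviations
  \<open>(f (v @ w) - f w)\<^sup>2\<close> over \<open>v\<close> and \<open>w\<close>. The terms with \<open>v = u\<close> alone contribute, by Jensen's inequality, at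
  least \<open>\<delta> = weight p u * (f u - 1)\<^sup>2\<close>, because additivity (\<open>app\<close>) makes \<open>f u\<close> the mean of \<open>f (u @ w)\<close> and
  \<open>1\<close> the mean of \<open>f w\<close>. Thus \<open>E\<close> grows by \<open>\<delta>\<close> with every \<open>k\<close> letters, while it is bounded by \<open>C\<^sup>2\<close>; so
  \<open>\<delta> = 0\<close>.
\<close>

lemma invariant_word_weights_unique:
  fixes m p :: "_ \<Rightarrow> real"
  assumes p: "\<And>i. i \<in> {1..d} \<Longrightarrow> 0 < p i" "(\<Sum>i\<in>{1..d}. p i) = 1"
    and one: "m [] = 1"
    and prep: "\<And>n w. w \<in> words d n \<Longrightarrow> m w = (\<Sum>a\<in>{1..d}. m (a # w))"
    and app: "\<And>n w. w \<in> words d n \<Longrightarrow> m w = (\<Sum>a\<in>{1..d}. m (w @ [a]))"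
    and bound: "\<And>n w. w \<in> words d n \<Longrightarrow> \<bar>m w\<bar> \<le> C * weight p w"
    and u: "u \<in> words d k"
  shows "m u = weight p u"
proof -
  have pos: "0 < weight p w" if "w \<in> words d n" for w n
    using weight_pos[of d p] p(1) that by blast
  have total: "(\<Sum>w\<in>words d n. weight p w) = 1" for n
    by (simp add: sum_words_weight p(2))
  have prep': "(\<Sum>v\<in>words d n. m (v @ w)) = m w" if "w \<in> words d l" for n w l
  proof (induction n)
    case (Suc n)
    have "(\<Sum>v\<in>words d (Suc n). m (v @ w)) = (\<Sum>v\<in>words d n. \<Sum>a\<in>{1..d}. m (a # v @ w))"
      by (subst sum.swap) (use sum_words_add[of "\<lambda>v. m (v @ w)" d "Suc 0" n] in \<open>simp add: sum_words_1\<close>)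
    also have "\<dots> = (\<Sum>v\<in>words d n. m (v @ w))"
      by (intro sum.cong refl prep[symmetric]) (rule words_append[OF _ that])
    finally show ?case
      using Suc by simp
  qed simp
  have app': "(\<Sum>v\<in>words d n. m (w @ v)) = m w" if "w \<in> words d l" for n w l
  proof (induction n)
    case (Suc n)
    have "(\<Sum>v\<in>words d (Suc n). m (w @ v)) = (\<Sum>v\<in>words d n. \<Sum>a\<in>{1..d}. m ((w @ v) @ [a]))"
      using sum_words_add[of "\<lambda>v. m (w @ v)" d n "Suc 0"] by (simp add: sum_words_1)
    also have "\<dots> = (\<Sum>v\<in>words d n. m (w @ v))"
      by (intro sum.cong refl app[symmetric]) (rule words_append[OF that])
    finally show ?case
      using Suc by simp
  qed simp

  define f where "f w = m w / weight p w" for w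
  define E where "E n = (\<Sum>w\<in>words d n. weight p w * (f w)\<^sup>2)" for n
  define \<delta> where "\<delta> = weight p u * (f u - 1)\<^sup>2"

  have step: "E n + \<delta> \<le> E (k + n)" for n
  proof -
    have variance: "(\<Sum>v\<in>words d k. weight p v * (f (v @ w) - f w)\<^sup>2)
        = (\<Sum>v\<in>words d k. weight p v * (f (v @ w))\<^sup>2) - (f w)\<^sup>2" if w: "w \<in> words d n" for w
    proof (rule weighted_variance)
      have "(\<Sum>v\<in>words d k. weight p v * f (v @ w)) = (\<Sum>v\<in>words d k. m (v @ w) / weight p w)"
      proof (intro sum.cong refl)
        fix v assume "v \<in> words d k"
        then show "weight p v * f (v @ w) = m (v @ w) / weight p w"
          using pos[of v k] pos[OF w] by (simp add: f_def)
      qed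
      then show "(\<Sum>v\<in>words d k. weight p v * f (v @ w)) = f w"
        by (simp add: sum_divide_distrib[symmetric] prep'[OF w] f_def)
    qed (use total in auto)
    have mean: "(\<Sum>w\<in>words d n. weight p w * (f (u @ w) - f w)) = f u - 1"
    proof -
      have "(\<Sum>w\<in>words d n. weight p w * (f (u @ w) - f w))
          = (\<Sum>w\<in>words d n. m (u @ w) / weight p u - m w)"
      proof (intro sum.cong refl)
        fix w assume "w \<in> words d n"
        then show "weight p w * (f (u @ w) - f w) = m (u @ w) / weight p u - m w"
          using pos[OF u] pos[of w n] by (simp add: f_def field_simps)
      qed
      also have "\<dots> = m u / weight p u - 1"
        using app'[OF u, of n] app'[of "[]" 0 n] one
        by (simp add: sum_subtractf sum_divide_distrib[symmetric])
      finally show ?thesis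
        by (simp add: f_def)
    qed
    have "\<delta> = weight p u * (\<Sum>w\<in>words d n. weight p w * (f (u @ w) - f w))\<^sup>2"
      by (simp add: \<delta>_def mean)
    also have "\<dots> \<le> weight p u * (\<Sum>w\<in>words d n. weight p w * (f (u @ w) - f w)\<^sup>2)"
      by (intro mult_left_mono weighted_jensen_square total) (auto intro: less_imp_le pos u)
    also have "\<dots> = (\<Sum>w\<in>words d n. weight p w * (weight p u * (f (u @ w) - f w)\<^sup>2))"
      by (simp add: sum_distrib_left mult_ac)
    also have "\<dots> \<le> (\<Sum>w\<in>words d n. weight p w * (\<Sum>v\<in>words d k. weight p v * (f (v @ w) - f w)\<^sup>2))"
    proof (intro sum_mono mult_left_mono)
      fix w assume "w \<in> words d n"
      then show "0 \<le> weight p w"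
        by (rule less_imp_le[OF pos])
      show "weight p u * (f (u @ w) - f w)\<^sup>2 \<le> (\<Sum>v\<in>words d k. weight p v * (f (v @ w) - f w)\<^sup>2)"
        using u by (rule member_le_sum) (auto intro!: mult_nonneg_nonneg intro: less_imp_le pos)
    qed
    also have "\<dots> = (\<Sum>w\<in>words d n. \<Sum>v\<in>words d k. weight p (v @ w) * (f (v @ w))\<^sup>2) - E n"
      unfolding E_def sum_subtractf[symmetric]
      by (intro sum.cong refl) (simp add: variance right_diff_distrib sum_distrib_left mult_ac)
    also have "(\<Sum>w\<in>words d n. \<Sum>v\<in>words d k. weight p (v @ w) * (f (v @ w))\<^sup>2) = E (k + n)"
      unfolding E_def by (subst sum_words_add) (rule sum.swap)
    finally show ?thesis by simp
  qed
  have lower: "of_nat n * \<delta> \<le> E (n * k)" for n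
  proof (induction n)
    case 0
    then show ?case
      by (auto simp: E_def)
  next
    case (Suc n)
    then show ?case
      using step[of "n * k"] by (simp add: algebra_simps)
  qed
  have upper: "E n \<le> C\<^sup>2" for n
  proof -
    have "E n \<le> (\<Sum>w\<in>words d n. weight p w * C\<^sup>2)"
      unfolding E_def
    proof (intro sum_mono mult_left_mono)
      fix w assume w: "w \<in> words d n"
      have "\<bar>f w\<bar> \<le> C"
        using bound[OF w] pos[OF w] by (simp add: f_def pos_divide_le_eq)
      then show "(f w)\<^sup>2 \<le> C\<^sup>2"
        using power_mono[of "\<bar>f w\<bar>" C 2] by simp
      show "0 \<le> weight p w"
        using pos[OF w] by simp
    qed
    then show ?thesis
      by (simp add: sum_distrib_right[symmetric] total)
  qed
  have "\<not> 0 < \<delta>"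
  proof
    assume "0 < \<delta>"
    from reals_Archimedean3[OF this] obtain n where "C\<^sup>2 < of_nat n * \<delta>"
      by blast
    then show False
      using lower[of n] upper[of "n * k"] by linarith
  qed
  then have "f u = 1"
    using pos[OF u] by (auto simp: \<delta>_def zero_less_mult_iff)
  then show ?thesis
    using pos[OF u] by (simp add: f_def)
qed


definition bernoulli :: "nat \<Rightarrow> (nat \<Rightarrow> real) \<Rightarrow> nat stream measure" where
  "bernoulli d p = stream_space (point_measure {1..d} (\<lambda>i. ennreal (p i)))"

lemma sstart_subset: "w \<in> words d n \<Longrightarrow> sstart {1..d} w \<subseteq> streams {1..d}"
  by (rule sstart_in_streams[OF words_lists])

lemma sstart_measurable:
  assumes "w \<in> words d n"
  shows "sstart {1..d} w \<in> sets (stream_space (count_space {1..d}))"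
proof -
  have "sstart {1..d} ` lists {1..d} \<union> {{}} \<subseteq> Pow (streams {1..d})"
    by (auto dest: sstart_in_streams del: in_listsD)
  then show ?thesis
    using words_lists[OF assms] by (simp add: sets_stream_space_sstart del: in_lists_conv_set)
qed

lemma sstart_nonempty:
  assumes "w \<in> words d n" "d \<ge> 1"
  shows "sstart {1..d} w \<noteq> {}"
proof -
  have "streams {1..d} \<noteq> {}"
    using assms(2) by (simp add: streams_empty_iff)
  then show ?thesis
    by (induction w) (auto simp: sstart.simps(2))
qed

lemma sstartD:
  assumes "x \<in> sstart {1..d} w" "w \<in> words d n"
  shows "x \<in> streams {1..d}" "stake n x = w"
proof -
  show x: "x \<in> streams {1..d}"
    using assms sstart_subset by blast
  show "stake n x = w"
    using assms x words_length[OF assms(2)] by (auto simp: list_eq_iff_nth_eq sstart_eq)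
qed

lemma in_streams_shd_stl: "x \<in> streams A \<longleftrightarrow> shd x \<in> A \<and> stl x \<in> streams A"
  by (cases x) (simp add: streams_Stream)

lemma sstart_append_one:
  assumes "w \<in> words d n"
  shows "sstart {1..d} w = (\<Union>a\<in>{1..d}. sstart {1..d} (w @ [a]))"
  using assms
proof (induction w arbitrary: n)
  case Nil
  show ?case
    by (rule set_eqI) (subst append_Nil, subst sstart.simps(1), subst in_streams_shd_stl, auto)
next
  case (Cons b w)
  then have "w \<in> words d (length w)"
    by (auto simp: words_def)
  from Cons.IH[OF this] show ?case
    by (auto simp: set_eq_iff)
qed

lemma stl_vimage_sstart:
  assumes "w \<in> words d n"
  shows "stl -` sstart {1..d} w \<inter> streams {1..d} = (\<Union>a\<in>{1..d}. sstart {1..d} (a # w))"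
proof (rule set_eqI)
  fix x
  show "x \<in> stl -` sstart {1..d} w \<inter> streams {1..d} \<longleftrightarrow> x \<in> (\<Union>a\<in>{1..d}. sstart {1..d} (a # w))"
    using sstart_subset[OF assms] by (subst Int_iff, subst in_streams_shd_stl) auto
qed

text \<open>
  Cylinders form a generator that is closed under intersection.
\<close>

lemma measure_eq_on_cylinders:
  fixes M N :: "nat stream measure"
  assumes M: "prob_space M" "sets M = sets (stream_space (count_space {1..d}))"
    and N: "prob_space N" "sets N = sets (stream_space (count_space {1..d}))"
    and eq: "\<And>n w. w \<in> words d n \<Longrightarrow> measure M (sstart {1..d} w) = measure N (sstart {1..d} w)"
  shows "M = N"
proof (rule measure_eqI_generator_eq[OF Int_stable_sstart[of "{1..d}"],
      where \<Omega> = "streams {1..d}" and A = "\<lambda>_. streams {1..d}"])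
  interpret M: prob_space M by fact
  interpret N: prob_space N by fact
  show sub: "sstart {1..d} ` lists {1..d} \<union> {{}} \<subseteq> Pow (streams {1..d})"
    by (auto dest: sstart_in_streams del: in_listsD)
  show "sets M = sigma_sets (streams {1..d}) (sstart {1..d} ` lists {1..d} \<union> {{}})"
       "sets N = sigma_sets (streams {1..d}) (sstart {1..d} ` lists {1..d} \<union> {{}})"
    using M(2) N(2) sub by (simp_all add: sets_stream_space_sstart)
  show "range (\<lambda>_::nat. streams {1..d}) \<subseteq> sstart {1..d} ` lists {1..d} \<union> {{}}"
    by (auto intro!: image_eqI[where x = "[]"])
  show "emeasure M (streams {1..d}) \<noteq> \<infinity>" for i :: nat
    by simp
  fix X assume "X \<in> sstart {1..d} ` lists {1..d} \<union> {{}}"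
  then show "emeasure M X = emeasure N X"
    using eq by (auto simp: M.emeasure_eq_measure N.emeasure_eq_measure words_def)
qed simp

text \<open>
  A cylinder is the disjoint union of its one-letter extensions on the right, and its preimage under
  the shift is the disjoint union of those on the left; so the measures of the cylinders form a
  function on words of the kind that the variance argument determines.
\<close>

lemma invariant_measure_eq_weight:
  fixes \<mu> :: "nat stream measure"
  assumes p: "\<And>i. i \<in> {1..d} \<Longrightarrow> 0 < p i" "(\<Sum>i\<in>{1..d}. p i) = 1"
    and "prob_space \<mu>" and sets: "sets \<mu> = sets (stream_space (count_space {1..d}))"
    and inv: "distr \<mu> \<mu> stl = \<mu>"
    and bound: "\<And>n w. w \<in> words d n \<Longrightarrow> measure \<mu> (sstart {1..d} w) \<le> C * weight p w"
    and u: "u \<in> words d k"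
  shows "measure \<mu> (sstart {1..d} u) = weight p u"
proof (rule invariant_word_weights_unique[where p = p and C = C, OF p _ _ _ _ u])
  interpret \<mu>: prob_space \<mu> by fact
  have space: "space \<mu> = streams {1..d}"
    using sets_eq_imp_space_eq[OF sets] by (simp add: space_stream_space)
  have cyl: "sstart {1..d} w \<in> sets \<mu>" if "w \<in> words d n" for w n
    using sstart_measurable[OF that] sets by simp
  show "measure \<mu> (sstart {1..d} []) = 1"
    using \<mu>.prob_space space by simp
  show "\<bar>measure \<mu> (sstart {1..d} w)\<bar> \<le> C * weight p w" if "w \<in> words d n" for w n
    using bound[OF that] by simp
  fix n w assume w: "w \<in> words d n"
  have "stl \<in> measurable \<mu> \<mu>"
    using measurable_stl[of "count_space {1..d}"] by (simp add: measurable_cong_sets[OF sets sets])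
  then have "measure \<mu> (sstart {1..d} w) = measure \<mu> (stl -` sstart {1..d} w \<inter> space \<mu>)"
    using measure_distr[of stl \<mu> \<mu> "sstart {1..d} w"] cyl[OF w] inv by simp
  also have "\<dots> = (\<Sum>a\<in>{1..d}. measure \<mu> (sstart {1..d} (a # w)))"
    unfolding space stl_vimage_sstart[OF w]
  proof (rule \<mu>.finite_measure_finite_Union)
    show "(\<lambda>a. sstart {1..d} (a # w)) ` {1..d} \<subseteq> sets \<mu>"
      using cyl[of "_ # w" "Suc n"] w by auto
    show "disjoint_family_on (\<lambda>a. sstart {1..d} (a # w)) {1..d}"
      by (auto simp: disjoint_family_on_def)
  qed simp
  finally show "measure \<mu> (sstart {1..d} w) = (\<Sum>a\<in>{1..d}. measure \<mu> (sstart {1..d} (a # w)))" .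
  have wa: "w @ [a] \<in> words d (n + 1)" if "a \<in> {1..d}" for a
    using words_append[OF w, of "[a]" 1] that by (simp add: words_def)
  show "measure \<mu> (sstart {1..d} w) = (\<Sum>a\<in>{1..d}. measure \<mu> (sstart {1..d} (w @ [a])))"
    unfolding sstart_append_one[OF w]
  proof (rule \<mu>.finite_measure_finite_Union)
    show "(\<lambda>a. sstart {1..d} (w @ [a])) ` {1..d} \<subseteq> sets \<mu>"
      using cyl[OF wa] by auto
    show "disjoint_family_on (\<lambda>a. sstart {1..d} (w @ [a])) {1..d}"
      unfolding disjoint_family_on_def
      using sstartD(2)[OF _ wa] by (metis disjoint_iff last_snoc)
  qed simp
qed

lemma
  assumes p: "\<And>i. i \<in> {1..d} \<Longrightarrow> 0 < p i" "(\<Sum>i\<in>{1..d}. p i) = 1"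
  shows prob_space_bernoulli: "prob_space (bernoulli d p)"
    and sets_bernoulli: "sets (bernoulli d p) = sets (stream_space (count_space {1..d}))"
    and measure_bernoulli: "w \<in> words d n \<Longrightarrow> measure (bernoulli d p) (sstart {1..d} w) = weight p w"
    and bernoulli_invariant: "distr (bernoulli d p) (bernoulli d p) stl = bernoulli d p"
proof -
  let ?M = "point_measure {1..d} (\<lambda>i. ennreal (p i))"
  have "(\<Sum>i\<in>{1..d}. ennreal (p i)) = ennreal (\<Sum>i\<in>{1..d}. p i)"
    using p(1) by (intro sum_ennreal) (auto intro: less_imp_le)
  then interpret M: prob_space ?M
    using p(2) by (intro prob_spaceI) (simp add: space_point_measure emeasure_point_measure_finite)
  show prob: "prob_space (bernoulli d p)"
    unfolding bernoulli_def by (rule M.prob_space_stream_space)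
  show sets: "sets (bernoulli d p) = sets (stream_space (count_space {1..d}))"
    unfolding bernoulli_def by (intro sets_stream_space_cong) (simp add: sets_point_measure)
  interpret B: prob_space "bernoulli d p" by fact
  have space: "space (bernoulli d p) = streams {1..d}"
    by (simp add: bernoulli_def space_stream_space space_point_measure)
  have cyl: "sstart {1..d} w \<in> sets (bernoulli d p)" if "w \<in> words d n" for w n
    using sstart_measurable[OF that] sets by simp
  have em: "emeasure (bernoulli d p) (sstart {1..d} w) = ennreal (weight p w)" if "w \<in> words d n" for w n
    using that
  proof (induction w arbitrary: n)
    case Nil
    then show ?case
      using B.emeasure_space_1 space by simp
  next
    case (Cons a w)
    then have a: "a \<in> {1..d}" and w: "w \<in> words d (length w)"
      by (auto simp: words_def)
    have "emeasure (bernoulli d p) (sstart {1..d} (a # w))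
        = (\<integral>\<^sup>+ t. emeasure (bernoulli d p)
              {x \<in> space (bernoulli d p). t ## x \<in> sstart {1..d} (a # w)} \<partial>?M)"
      using M.emeasure_stream_space[of "sstart {1..d} (a # w)"] cyl[OF Cons.prems]
      by (simp add: bernoulli_def)
    also have "\<dots> = (\<Sum>t\<in>{1..d}. ennreal (p t) * emeasure (bernoulli d p)
              {x \<in> space (bernoulli d p). t ## x \<in> sstart {1..d} (a # w)})"
      by (subst nn_integral_point_measure_finite) auto
    also have "\<dots> = (\<Sum>t\<in>{1..d}. if t = a then ennreal (p a) * ennreal (weight p w) else 0)"
    proof (intro sum.cong refl)
      fix t
      have "{x \<in> space (bernoulli d p). t ## x \<in> sstart {1..d} (a # w)}
          = (if t = a then sstart {1..d} w else {})"
        using sstart_subset[OF w] space by auto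
      then show "ennreal (p t) * emeasure (bernoulli d p)
              {x \<in> space (bernoulli d p). t ## x \<in> sstart {1..d} (a # w)}
          = (if t = a then ennreal (p a) * ennreal (weight p w) else 0)"
        using Cons.IH[OF w] by simp
    qed
    also have "\<dots> = ennreal (p a) * ennreal (weight p w)"
      using a by simp
    also have "\<dots> = ennreal (weight p (a # w))"
      using p(1)[OF a] weight_pos[of d p, OF p(1) w] by (simp add: ennreal_mult)
    finally show ?case .
  qed
  show meas: "measure (bernoulli d p) (sstart {1..d} w) = weight p w" if "w \<in> words d n" for w n
    using em[OF that] weight_pos[of d p, OF p(1) that] by (simp add: measure_def)
  have stl: "stl \<in> measurable (bernoulli d p) (bernoulli d p)"
    using measurable_stl[of ?M] by (simp add: bernoulli_def)
  show "distr (bernoulli d p) (bernoulli d p) stl = bernoulli d p"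
  proof (rule measure_eq_on_cylinders[OF _ _ prob sets])
    show "prob_space (distr (bernoulli d p) (bernoulli d p) stl)"
      by (rule B.prob_space_distr[OF stl])
    fix n w assume w: "w \<in> words d n"
    have "measure (distr (bernoulli d p) (bernoulli d p) stl) (sstart {1..d} w)
        = measure (bernoulli d p) (\<Union>a\<in>{1..d}. sstart {1..d} (a # w))"
      using measure_distr[OF stl cyl[OF w]] stl_vimage_sstart[OF w] space by simp
    also have "\<dots> = (\<Sum>a\<in>{1..d}. measure (bernoulli d p) (sstart {1..d} (a # w)))"
    proof (rule B.finite_measure_finite_Union)
      show "(\<lambda>a. sstart {1..d} (a # w)) ` {1..d} \<subseteq> sets (bernoulli d p)"
        using cyl[of "_ # w" "Suc n"] w by auto
      show "disjoint_family_on (\<lambda>a. sstart {1..d} (a # w)) {1..d}"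
        by (auto simp: disjoint_family_on_def)
    qed simp
    also have "\<dots> = (\<Sum>a\<in>{1..d}. p a * weight p w)"
      using meas[of "_ # w" "Suc n"] w by (intro sum.cong) auto
    finally show "measure (distr (bernoulli d p) (bernoulli d p) stl) (sstart {1..d} w)
        = measure (bernoulli d p) (sstart {1..d} w)"
      using p(2) meas[OF w] by (simp add: sum_distrib_right[symmetric])
  qed (use sets in simp)
qed


section \<open>Limit sets and coding\<close>

lemma comp_word_Nil [simp]: "comp_word f [] x = x"
  and comp_word_Cons [simp]: "comp_word f (a # w) x = f a (comp_word f w x)"
  by (simp_all add: comp_word_def)

lemma comp_word_append: "comp_word f (v @ w) x = comp_word f v (comp_word f w x)"
  by (induction v) auto

lemma comp_word_map: "comp_word f (map \<tau> w) x = comp_word (\<lambda>i. f (\<tau> i)) w x"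
  by (induction w) auto

lemma comp_word_in:
  assumes "\<And>i. i \<in> {1..d} \<Longrightarrow> f i ` S \<subseteq> S" "w \<in> words d n" "x \<in> S"
  shows "comp_word f w x \<in> S"
  using assms(2)
proof (induction w arbitrary: n)
  case (Cons a w)
  then have "a \<in> {1..d}" "w \<in> words d (length w)"
    by (auto simp: words_def)
  then show ?case
    using Cons.IH assms(1) by (auto simp: image_subset_iff)
qed (use assms(3) in auto)

lemma CS_D:
  assumes "CS d \<Phi>"
  shows "compact (base \<Phi>)" "connected (base \<Phi>)" "base \<Phi> \<noteq> {}"
    and "i \<in> {1..d} \<Longrightarrow> gen \<Phi> i ` base \<Phi> \<subseteq> interior (base \<Phi>)"
    and "i \<in> {1..d} \<Longrightarrow> gen \<Phi> i ` base \<Phi> \<subseteq> base \<Phi>"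
    and "i \<in> {1..d} \<Longrightarrow> inj_on (gen \<Phi> i) (base \<Phi>)"
    and "i \<in> {1..d} \<Longrightarrow> j \<in> {1..d} \<Longrightarrow> i \<noteq> j \<Longrightarrow>
        gen \<Phi> i ` interior (base \<Phi>) \<inter> gen \<Phi> j ` interior (base \<Phi>) = {}"
    and "i \<in> {1..d} \<Longrightarrow> \<exists>c<1. c-lipschitz_on (base \<Phi>) (gen \<Phi> i)"
    and "\<exists>U f. conformal_ext d \<Phi> U f \<and> bounded_distortion d U f"
proof -
  show "compact (base \<Phi>)"
    using assms unfolding CS_def by (elim conjE)
  show "connected (base \<Phi>)"
    using assms unfolding CS_def by (elim conjE)
  show "base \<Phi> \<noteq> {}"
    using assms unfolding CS_def by (elim conjE)
  have maps: "\<forall>i\<in>{1..d}. gen \<Phi> i ` base \<Phi> \<subseteq> interior (base \<Phi>) \<and> inj_on (gen \<Phi> i) (base \<Phi>) \<and>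
      (\<exists>c<1. c-lipschitz_on (base \<Phi>) (gen \<Phi> i))"
    using assms unfolding CS_def by (elim conjE)
  have disjoint: "\<forall>i\<in>{1..d}. \<forall>j\<in>{1..d}. i \<noteq> j \<longrightarrow>
      gen \<Phi> i ` interior (base \<Phi>) \<inter> gen \<Phi> j ` interior (base \<Phi>) = {}"
    using assms unfolding CS_def by (elim conjE)
  show "gen \<Phi> i ` interior (base \<Phi>) \<inter> gen \<Phi> j ` interior (base \<Phi>) = {}"
    if "i \<in> {1..d}" "j \<in> {1..d}" "i \<noteq> j"
    using disjoint that by blast
  show lip: "\<exists>c<1. c-lipschitz_on (base \<Phi>) (gen \<Phi> i)"
    and into: "gen \<Phi> i ` base \<Phi> \<subseteq> interior (base \<Phi>)"
    and "inj_on (gen \<Phi> i) (base \<Phi>)" if "i \<in> {1..d}"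
    using maps that by blast+
  show "gen \<Phi> i ` base \<Phi> \<subseteq> base \<Phi>" if "i \<in> {1..d}"
    using into[OF that] interior_subset by (rule subset_trans)
  show "\<exists>U f. conformal_ext d \<Phi> U f \<and> bounded_distortion d U f"
    using assms unfolding CS_def by (elim conjE)
qed

lemma CS_contraction:
  assumes "CS d \<Phi>"
  obtains c where "0 \<le> c" "c < 1"
    and "\<And>i x y. i \<in> {1..d} \<Longrightarrow> x \<in> base \<Phi> \<Longrightarrow> y \<in> base \<Phi> \<Longrightarrow>
          \<bar>gen \<Phi> i x - gen \<Phi> i y\<bar> \<le> c * \<bar>x - y\<bar>"
proof -
  have "\<forall>i\<in>{1..d}. \<exists>c<1. c-lipschitz_on (base \<Phi>) (gen \<Phi> i)"
    using CS_D(8)[OF assms] by blast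
  then obtain c where c: "\<And>i. i \<in> {1..d} \<Longrightarrow> c i < 1 \<and> (c i)-lipschitz_on (base \<Phi>) (gen \<Phi> i)"
    by metis
  define m where "m = Max (insert 0 (c ` {1..d}))"
  show ?thesis
  proof
    show "0 \<le> m" "m < 1"
      using c by (auto simp: m_def)
    fix i x y assume i: "i \<in> {1..d}" and x: "x \<in> base \<Phi>" and y: "y \<in> base \<Phi>"
    have "\<bar>gen \<Phi> i x - gen \<Phi> i y\<bar> \<le> c i * \<bar>x - y\<bar>"
      using lipschitz_onD[OF conjunct2[OF c[OF i]] x y] by (simp add: dist_real_def)
    also have "c i \<le> m"
      unfolding m_def by (rule Max_ge) (use i in auto)
    finally show "\<bar>gen \<Phi> i x - gen \<Phi> i y\<bar> \<le> m * \<bar>x - y\<bar>"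
      by (simp add: mult_right_mono)
  qed
qed

lemma CS_word_in_base:
  assumes "CS d \<Phi>" "w \<in> words d n" "x \<in> base \<Phi>"
  shows "comp_word (gen \<Phi>) w x \<in> base \<Phi>"
  using comp_word_in[OF CS_D(5)[OF assms(1)] assms(2,3)] .

lemma CS_word_contraction:
  assumes "CS d \<Phi>" and c: "0 \<le> c"
    "\<And>i x y. i \<in> {1..d} \<Longrightarrow> x \<in> base \<Phi> \<Longrightarrow> y \<in> base \<Phi> \<Longrightarrow>
          \<bar>gen \<Phi> i x - gen \<Phi> i y\<bar> \<le> c * \<bar>x - y\<bar>"
    and "w \<in> words d n" and xy: "x \<in> base \<Phi>" "y \<in> base \<Phi>"
  shows "\<bar>comp_word (gen \<Phi>) w x - comp_word (gen \<Phi>) w y\<bar> \<le> c ^ n * \<bar>x - y\<bar>"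
  using assms(4)
proof (induction w arbitrary: n)
  case (Cons a w)
  then obtain m where m: "n = Suc m" and a: "a \<in> {1..d}" and w: "w \<in> words d m"
    by (auto simp: words_def)
  have "\<bar>comp_word (gen \<Phi>) (a # w) x - comp_word (gen \<Phi>) (a # w) y\<bar>
      \<le> c * \<bar>comp_word (gen \<Phi>) w x - comp_word (gen \<Phi>) w y\<bar>"
    using c(2)[OF a] CS_word_in_base[OF assms(1) w] xy by simp
  also have "\<dots> \<le> c * (c ^ m * \<bar>x - y\<bar>)"
    by (intro mult_left_mono Cons.IH[OF w] c(1))
  finally show ?case
    by (simp add: m mult_ac)
qed (auto simp: words_def)

lemma CS_word_continuous:
  assumes "CS d \<Phi>" "w \<in> words d n"
  shows "continuous_on (base \<Phi>) (comp_word (gen \<Phi>) w)"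
proof -
  obtain c where c: "0 \<le> c" "c < 1"
    "\<And>i x y. i \<in> {1..d} \<Longrightarrow> x \<in> base \<Phi> \<Longrightarrow> y \<in> base \<Phi> \<Longrightarrow>
          \<bar>gen \<Phi> i x - gen \<Phi> i y\<bar> \<le> c * \<bar>x - y\<bar>"
    using CS_contraction[OF assms(1)] by blast
  have "(c ^ n)-lipschitz_on (base \<Phi>) (comp_word (gen \<Phi>) w)"
    using CS_word_contraction[OF assms(1) c(1,3) assms(2)] c(1)
    by (intro lipschitz_onI) (auto simp: dist_real_def)
  then show ?thesis
    by (rule lipschitz_on_continuous_on)
qed

lemma stake_words: "x \<in> streams {1..d} \<Longrightarrow> stake n x \<in> words d n"
proof (induction n arbitrary: x)
  case (Suc n)
  then show ?case
    using Suc.IH[OF streams_stl[OF Suc.prems]] streams_shd[OF Suc.prems] by simp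
qed simp

lemma streams_sdrop: "x \<in> streams A \<Longrightarrow> sdrop n x \<in> streams A"
  by (induction n arbitrary: x) (simp_all add: streams_stl)

text \<open>
  The images of the base along the prefixes of \<open>x\<close> are nested, compact and nonempty, and the common
  contraction factor makes their diameters tend to \<open>0\<close>.
\<close>

lemma coding_point:
  assumes "CS d \<Phi>" "x \<in> streams {1..d}"
  shows "(\<Inter>n. comp_word (gen \<Phi>) (stake n x) ` base \<Phi>) = {coding \<Phi> x}"
proof -
  let ?X = "base \<Phi>" and ?K = "\<lambda>n. comp_word (gen \<Phi>) (stake n x) ` base \<Phi>"
  note w = stake_words[OF assms(2)]
  obtain c where c: "0 \<le> c" "c < 1"
    "\<And>i x y. i \<in> {1..d} \<Longrightarrow> x \<in> ?X \<Longrightarrow> y \<in> ?X \<Longrightarrow> \<bar>gen \<Phi> i x - gen \<Phi> i y\<bar> \<le> c * \<bar>x - y\<bar>"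
    using CS_contraction[OF assms(1)] by blast
  have "\<exists>a. \<Inter>(range ?K) = {a}"
  proof (rule decreasing_closed_nest_sing)
    show "closed (?K n)" for n
      by (rule compact_imp_closed[OF compact_continuous_image[OF
              CS_word_continuous[OF assms(1) w] CS_D(1)[OF assms(1)]]])
    show "?K n \<noteq> {}" for n
      using CS_D(3)[OF assms(1)] by simp
    show "?K n \<subseteq> ?K m" if "m \<le> n" for m n
    proof -
      obtain k where k: "n = m + k"
        using le_Suc_ex[OF \<open>m \<le> n\<close>] by blast
      have in_X: "comp_word (gen \<Phi>) (stake k (sdrop m x)) y \<in> ?X" if "y \<in> ?X" for y
        by (rule CS_word_in_base[OF assms(1) stake_words[OF streams_sdrop[OF assms(2)]] that])
      have "stake n x = stake m x @ stake k (sdrop m x)"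
        unfolding k by (rule stake_add[symmetric])
      then have "comp_word (gen \<Phi>) (stake n x) y
          = comp_word (gen \<Phi>) (stake m x) (comp_word (gen \<Phi>) (stake k (sdrop m x)) y)" for y
        by (simp only: comp_word_append)
      with in_X show ?thesis
        by (auto simp only: image_subset_iff)
    qed
    fix e :: real assume "0 < e"
    obtain D where D: "\<And>y z. y \<in> ?X \<Longrightarrow> z \<in> ?X \<Longrightarrow> \<bar>y - z\<bar> \<le> D"
      using compact_imp_bounded[OF CS_D(1)[OF assms(1)]]
      unfolding bounded_two_points dist_real_def by blast
    have "(\<lambda>n. c ^ n * D) \<longlonglongrightarrow> 0 * D"
      by (intro tendsto_mult tendsto_const LIMSEQ_realpow_zero c)
    then have "\<forall>\<^sub>F n in sequentially. c ^ n * D < e"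
      using \<open>0 < e\<close> order_tendstoD(2)[of "\<lambda>n. c ^ n * D" "0 * D" sequentially e] by simp
    then obtain n where n: "c ^ n * D < e"
      by (auto simp: eventually_sequentially)
    have "dist y z < e" if "y \<in> ?K n" "z \<in> ?K n" for y z
    proof -
      obtain y' z' where yz: "y' \<in> ?X" "z' \<in> ?X" and
        eq: "y = comp_word (gen \<Phi>) (stake n x) y'" "z = comp_word (gen \<Phi>) (stake n x) z'"
        using \<open>y \<in> ?K n\<close> \<open>z \<in> ?K n\<close> by auto
      have "dist y z \<le> c ^ n * \<bar>y' - z'\<bar>"
        using CS_word_contraction[OF assms(1) c(1,3) w yz] by (simp add: dist_real_def eq)
      also have "\<dots> \<le> c ^ n * D"
        using c(1) by (intro mult_left_mono D yz) auto
      finally show ?thesis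
        using n by simp
    qed
    then show "\<exists>n. \<forall>y\<in>?K n. \<forall>z\<in>?K n. dist y z < e"
      by blast
  qed
  then obtain a where "\<Inter>(range ?K) = {a}"
    by blast
  then show ?thesis
    by (simp add: coding_def)
qed

lemma coding_in:
  assumes "CS d \<Phi>" "x \<in> streams {1..d}"
  shows "coding \<Phi> x \<in> comp_word (gen \<Phi>) (stake n x) ` base \<Phi>"
  using coding_point[OF assms] by blast

lemma coding_in_limit_set:
  assumes "CS d \<Phi>" "x \<in> streams {1..d}"
  shows "coding \<Phi> x \<in> limit_set d \<Phi>"
  using coding_in[OF assms] stake_words[OF assms(2)] unfolding limit_set_def by blast

lemma limit_set_subset_interior:
  assumes "CS d \<Phi>"
  shows "limit_set d \<Phi> \<subseteq> interior (base \<Phi>)"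
proof
  fix x assume "x \<in> limit_set d \<Phi>"
  then obtain w y where w: "w \<in> words d 1" and y: "y \<in> base \<Phi>" "x = comp_word (gen \<Phi>) w y"
    unfolding limit_set_def by blast
  obtain i where "w = [i]" "i \<in> {1..d}"
    using w by (auto simp: words_def length_Suc_conv One_nat_def)
  then show "x \<in> interior (base \<Phi>)"
    using CS_D(4)[OF assms] y by auto
qed

lemma limit_set_subset_base: "CS d \<Phi> \<Longrightarrow> limit_set d \<Phi> \<subseteq> base \<Phi>"
  using limit_set_subset_interior interior_subset by blast

lemma gen_limit_set:
  assumes "CS d \<Phi>" and i: "i \<in> {1..d}"
  shows "gen \<Phi> i ` limit_set d \<Phi> \<subseteq> limit_set d \<Phi>"
proof safe
  fix x assume x: "x \<in> limit_set d \<Phi>"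
  show "gen \<Phi> i x \<in> limit_set d \<Phi>"
    unfolding limit_set_def
  proof safe
    fix n
    show "gen \<Phi> i x \<in> (\<Union>w\<in>words d n. comp_word (gen \<Phi>) w ` base \<Phi>)"
    proof (cases n)
      case 0
      then show ?thesis
        using CS_D(5)[OF assms] limit_set_subset_base[OF assms(1)] x by auto
    next
      case (Suc m)
      obtain w y where "w \<in> words d m" "y \<in> base \<Phi>" "x = comp_word (gen \<Phi>) w y"
        using x unfolding limit_set_def by blast
      then show ?thesis
        using i by (intro UN_I[of "i # w"]) (auto simp: Suc)
    qed
  qed
qed

lemma word_limit_set:
  assumes "CS d \<Phi>" "w \<in> words d n" "x \<in> limit_set d \<Phi>"
  shows "comp_word (gen \<Phi>) w x \<in> limit_set d \<Phi>"
  using comp_word_in[OF gen_limit_set[OF assms(1)] assms(2,3)] .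

lemma coding_stl:
  assumes "CS d \<Phi>" "x \<in> streams {1..d}"
  shows "coding \<Phi> x = gen \<Phi> (shd x) (coding \<Phi> (stl x))"
proof -
  have i: "shd x \<in> {1..d}" and stl: "stl x \<in> streams {1..d}"
    using streams_shd[OF assms(2)] streams_stl[OF assms(2)] .
  have "gen \<Phi> (shd x) (coding \<Phi> (stl x)) \<in> comp_word (gen \<Phi>) (stake n x) ` base \<Phi>" for n
  proof (cases n)
    case 0
    then show ?thesis
      using CS_D(5)[OF assms(1) i] limit_set_subset_base[OF assms(1)]
        coding_in_limit_set[OF assms(1) stl] by auto
  next
    case (Suc m)
    obtain y where "y \<in> base \<Phi>" "coding \<Phi> (stl x) = comp_word (gen \<Phi>) (stake m (stl x)) y"
      using coding_in[OF assms(1) stl, of m] by blast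
    then show ?thesis
      by (intro image_eqI[of _ _ y]) (simp_all add: Suc)
  qed
  then have "gen \<Phi> (shd x) (coding \<Phi> (stl x)) \<in> (\<Inter>n. comp_word (gen \<Phi>) (stake n x) ` base \<Phi>)"
    by (rule INT_I)
  then show ?thesis
    unfolding coding_point[OF assms] by simp
qed


lemma coding_sdrop:
  assumes "CS d \<Phi>" "x \<in> streams {1..d}"
  shows "coding \<Phi> x = comp_word (gen \<Phi>) (stake n x) (coding \<Phi> (sdrop n x))"
  using assms(2)
proof (induction n arbitrary: x)
  case (Suc n)
  show ?case
    by (subst coding_stl[OF assms(1) Suc.prems], subst Suc.IH[OF streams_stl[OF Suc.prems]]) simp
qed simp

text \<open>
  The open set condition separates the images of an interior point under the first two generators.
  Two distinct points are needed to read the size of a composition off a distance.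
\<close>

lemma limit_set_two_points:
  assumes "CS d \<Phi>" "d \<ge> 2"
  obtains p q where "p \<in> limit_set d \<Phi>" "q \<in> limit_set d \<Phi>" "p \<noteq> q"
proof -
  have I: "1 \<in> {1..d}" "2 \<in> {1..d}"
    using assms(2) by auto
  define x where "x = coding \<Phi> (sconst 1)"
  have x: "x \<in> limit_set d \<Phi>"
    unfolding x_def by (rule coding_in_limit_set[OF assms(1) sconst_streams[OF I(1)]])
  have "gen \<Phi> 1 x \<noteq> gen \<Phi> 2 x"
    using CS_D(7)[OF assms(1) I] limit_set_subset_interior[OF assms(1)] x by fastforce
  then show ?thesis
    using that[of "gen \<Phi> 1 x" "gen \<Phi> 2 x"] gen_limit_set[OF assms(1)] I x by blast
qed



section \<open>Distances in the limit set and the geometric potential\<close>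

text \<open>
  A holomorphic function that is real on a real interval has a real derivative there, so the real
  derivative of a generator and the complex derivative of its extension have the same size.
\<close>

lemma real_derivative_of_holomorphic:
  fixes g :: "real \<Rightarrow> real"
  assumes "F holomorphic_on U" "open U" "complex_of_real ` X \<subseteq> U"
    and eq: "\<And>y. y \<in> X \<Longrightarrow> F (of_real y) = of_real (g y)"
    and x: "x \<in> interior X"
  shows "(g has_real_derivative Re (deriv F (of_real x))) (at x)"
    and "\<bar>Re (deriv F (of_real x))\<bar> = cmod (deriv F (of_real x))"
proof -
  let ?D = "deriv F (of_real x)"
  have "of_real x \<in> U"
    using x assms(3) interior_subset by blast
  then have "(F has_field_derivative ?D) (at (of_real x))"
    by (rule holomorphic_derivI[OF assms(1,2)])
  then have "((\<lambda>y. F (of_real y)) has_vector_derivative ?D) (at x)"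
    by (rule has_vector_derivative_real_field)
  then have *: "((\<lambda>y. of_real (g y)) has_vector_derivative ?D) (at x)"
    by (rule has_vector_derivative_transform_within_open[OF _ open_interior x])
       (use eq interior_subset in blast)
  show "(g has_real_derivative Re ?D) (at x)"
    using bounded_linear.has_vector_derivative[OF bounded_linear_Re *]
    by (simp add: has_real_derivative_iff_has_vector_derivative)
  have "((\<lambda>y. 0) has_vector_derivative Im ?D) (at x)"
    using bounded_linear.has_vector_derivative[OF bounded_linear_Im *] by simp
  then have "Im ?D = 0"
    using vector_derivative_unique_at has_vector_derivative_const by blast
  then show "\<bar>Re ?D\<bar> = cmod ?D"
    by (simp add: cmod_def)
qed

lemma conformal_word:
  assumes "conformal_ext d \<Phi> U f" "CS d \<Phi>" "w \<in> words d n"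
  shows "comp_word f w holomorphic_on U" "comp_word f w ` U \<subseteq> U"
    and "\<And>x. x \<in> base \<Phi> \<Longrightarrow> comp_word f w (of_real x) = of_real (comp_word (gen \<Phi>) w x)"
proof -
  have f: "f i holomorphic_on U" "f i ` U \<subseteq> U"
    "x \<in> base \<Phi> \<Longrightarrow> f i (of_real x) = of_real (gen \<Phi> i x)" if "i \<in> {1..d}" for i x
    using assms(1) that unfolding conformal_ext_def by blast+
  have sub: "comp_word f w ` U \<subseteq> U" if "w \<in> words d n" for w n
    using comp_word_in[of d f U, OF f(2) that] by blast
  show "comp_word f w ` U \<subseteq> U"
    by (rule sub[OF assms(3)])
  show "comp_word f w holomorphic_on U"
    using assms(3)
  proof (induction w arbitrary: n)
    case Nil
    have "comp_word f [] = (\<lambda>x. x)"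
      by auto
    then show ?case
      by simp
  next
    case (Cons a w)
    then have a: "a \<in> {1..d}" and w: "w \<in> words d (length w)"
      by (auto simp: words_def)
    have "(f a \<circ> comp_word f w) holomorphic_on U"
      by (rule holomorphic_on_compose_gen[OF Cons.IH[OF w] f(1)[OF a] sub[OF w]])
    moreover have "comp_word f (a # w) = f a \<circ> comp_word f w"
      by auto
    ultimately show ?case
      by (simp only:)
  qed
  fix x assume x: "x \<in> base \<Phi>"
  show "comp_word f w (of_real x) = of_real (comp_word (gen \<Phi>) w x)"
    using assms(3)
  proof (induction w arbitrary: n)
    case (Cons a w)
    then have a: "a \<in> {1..d}" and w: "w \<in> words d (length w)"
      by (auto simp: words_def)
    then show ?case
      using f(3)[OF a CS_word_in_base[OF assms(2) w x]] Cons.IH[OF w] by simp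
  qed simp
qed

text \<open>
  The chain rule: along the orbit of \<open>x\<close>, the factor contributed by the letter \<open>x\<^sub>k\<close> is the derivative
  of its generator at the image of the coding point of the shifted sequence, which is again a coding
  point.
\<close>

lemma exp_birkhoff_sum_eq_derivative:
  assumes ext: "conformal_ext d \<Phi> U f" and "CS d \<Phi>" and "x \<in> streams {1..d}"
  shows "exp (birkhoff_sum n (geom_potential \<Phi>) x)
      = cmod (deriv (comp_word f (stake n x)) (of_real (coding \<Phi> (sdrop n x))))"
  using assms(3)
proof (induction n arbitrary: x)
  case 0
  have "comp_word f [] = (\<lambda>x. x)"
    by auto
  then show ?case
    by (simp add: birkhoff_sum_def)
next
  case (Suc n)
  let ?a = "shd x" and ?w = "stake n (stl x)" and ?z = "complex_of_real (coding \<Phi> (sdrop n (stl x)))"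
  have U: "open U" "complex_of_real ` base \<Phi> \<subseteq> U"
    using ext unfolding conformal_ext_def by blast+
  have a: "?a \<in> {1..d}" and stl: "stl x \<in> streams {1..d}"
    using streams_shd[OF Suc.prems] streams_stl[OF Suc.prems] .
  have f: "f ?a holomorphic_on U" "inj_on (f ?a) U"
    "\<And>y. y \<in> base \<Phi> \<Longrightarrow> f ?a (of_real y) = of_real (gen \<Phi> ?a y)"
    using ext a unfolding conformal_ext_def by blast+
  note w = stake_words[OF stl, of n]
  have sd: "sdrop n (stl x) \<in> streams {1..d}"
    by (rule streams_sdrop[OF stl])
  have limit: "coding \<Phi> y \<in> interior (base \<Phi>)" if "y \<in> streams {1..d}" for y
    using coding_in_limit_set[OF assms(2) that] limit_set_subset_interior[OF assms(2)] by blast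
  have image: "comp_word f ?w ?z = of_real (coding \<Phi> (stl x))"
    using conformal_word(3)[OF ext assms(2) w, of "coding \<Phi> (sdrop n (stl x))"]
      coding_sdrop[OF assms(2) stl, of n] limit[OF sd] interior_subset[of "base \<Phi>"] by auto
  have z: "?z \<in> U" and z': "complex_of_real (coding \<Phi> (stl x)) \<in> U"
    using limit[OF sd] limit[OF stl] U(2) interior_subset by blast+
  \<comment> \<open>Injectivity is what makes the logarithm in the potential a logarithm of a positive number.\<close>
  have "deriv (f ?a) (of_real (coding \<Phi> (stl x))) \<noteq> 0"
    by (rule holomorphic_injective_imp_regular[OF f(1) U(1) f(2) z'])
  moreover have "\<bar>deriv (gen \<Phi> ?a) (coding \<Phi> (stl x))\<bar> = cmod (deriv (f ?a) (of_real (coding \<Phi> (stl x))))"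
    using real_derivative_of_holomorphic[OF f(1) U f(3) limit[OF stl]]
    by (simp add: DERIV_imp_deriv)
  ultimately have potential: "exp (geom_potential \<Phi> x) = cmod (deriv (f ?a) (of_real (coding \<Phi> (stl x))))"
    by (simp add: geom_potential_def)
  have "deriv (f ?a \<circ> comp_word f ?w) ?z = deriv (f ?a) (comp_word f ?w ?z) * deriv (comp_word f ?w) ?z"
  proof (rule deriv_chain)
    show "comp_word f ?w field_differentiable at ?z"
      by (rule holomorphic_on_imp_differentiable_at[OF conformal_word(1)[OF ext assms(2) w] U(1) z])
    show "f ?a field_differentiable at (comp_word f ?w ?z)"
      unfolding image by (rule holomorphic_on_imp_differentiable_at[OF f(1) U(1) z'])
  qed
  moreover have "comp_word f (stake (Suc n) x) = f ?a \<circ> comp_word f ?w"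
    by auto
  moreover have "birkhoff_sum (Suc n) (geom_potential \<Phi>) x
      = geom_potential \<Phi> x + birkhoff_sum n (geom_potential \<Phi>) (stl x)"
    unfolding birkhoff_sum_def by (subst sum.lessThan_Suc_shift) simp
  ultimately show ?case
    using Suc.IH[OF stl] by (simp only: image exp_add potential norm_mult sdrop.simps)
qed

text \<open>
  By the mean value theorem \<open>\<bar>\<phi>\<^sub>w p - \<phi>\<^sub>w q\<bar> / \<bar>p - q\<bar>\<close> is the size of the derivative of \<open>\<phi>\<^sub>w\<close> at some point, and
  by bounded distortion it is comparable to the size at the coding point of the shifted sequence, which
  is the exponential of the Birkhoff sum.
\<close>

lemma distances_comparable_to_potential:
  assumes "CS d \<Phi>"
  obtains C where "C \<ge> 1"
    and "\<And>n w x p q. w \<in> words d n \<Longrightarrow> x \<in> sstart {1..d} w \<Longrightarrow>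
          p \<in> limit_set d \<Phi> \<Longrightarrow> q \<in> limit_set d \<Phi> \<Longrightarrow>
          exp (birkhoff_sum n (geom_potential \<Phi>) x) * \<bar>p - q\<bar>
            \<le> C * \<bar>comp_word (gen \<Phi>) w p - comp_word (gen \<Phi>) w q\<bar>"
    and "\<And>n w x p q. w \<in> words d n \<Longrightarrow> x \<in> sstart {1..d} w \<Longrightarrow>
          p \<in> limit_set d \<Phi> \<Longrightarrow> q \<in> limit_set d \<Phi> \<Longrightarrow>
          \<bar>comp_word (gen \<Phi>) w p - comp_word (gen \<Phi>) w q\<bar>
            \<le> C * (exp (birkhoff_sum n (geom_potential \<Phi>) x) * \<bar>p - q\<bar>)"
proof -
  obtain U f where ext: "conformal_ext d \<Phi> U f" and "bounded_distortion d U f"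
    using CS_D(9)[OF assms] by blast
  then obtain C where C: "C \<ge> 1" and dist: "\<And>n w x y. w \<in> words d n \<Longrightarrow> x \<in> U \<Longrightarrow> y \<in> U \<Longrightarrow>
      cmod (deriv (comp_word f w) y) \<le> C * cmod (deriv (comp_word f w) x)"
    unfolding bounded_distortion_def by blast
  have U: "open U" "complex_of_real ` base \<Phi> \<subseteq> U"
    using ext unfolding conformal_ext_def by blast+
  have "convex (interior (base \<Phi>))"
    using CS_D(2)[OF assms] by (simp add: is_interval_connected_1[symmetric] is_interval_convex convex_interior)
  have main: "\<exists>z\<in>U. \<bar>comp_word (gen \<Phi>) w p - comp_word (gen \<Phi>) w q\<bar>
      = cmod (deriv (comp_word f w) z) * \<bar>p - q\<bar>"
    if w: "w \<in> words d n" and p: "p \<in> limit_set d \<Phi>" and q: "q \<in> limit_set d \<Phi>" and "p < q" for w n p q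
  proof -
    let ?g = "comp_word (gen \<Phi>) w" and ?D = "\<lambda>t. deriv (comp_word f w) (of_real t)"
    have int: "t \<in> interior (base \<Phi>)" if "p \<le> t" "t \<le> q" for t
    proof -
      have "{p..q} \<subseteq> interior (base \<Phi>)"
        using \<open>convex (interior (base \<Phi>))\<close> p q limit_set_subset_interior[OF assms] \<open>p < q\<close>
          closed_segment_subset[of p "interior (base \<Phi>)" q]
        by (auto simp: closed_segment_eq_real_ivl)
      then show ?thesis
        using that by auto
    qed
    have D: "(?g has_real_derivative Re (?D t)) (at t)" "\<bar>Re (?D t)\<bar> = cmod (?D t)"
      if "t \<in> interior (base \<Phi>)" for t
      using real_derivative_of_holomorphic[OF conformal_word(1)[OF ext assms w] U _ that]
        conformal_word(3)[OF ext assms w] by simp_all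
    have "\<exists>t>p. t < q \<and> ?g q - ?g p = (q - p) * Re (?D t)"
      by (rule MVT2[OF \<open>p < q\<close>]) (use D(1) int in blast)
    then obtain t where t: "p < t" "t < q" "?g q - ?g p = (q - p) * Re (?D t)"
      by blast
    have t': "t \<in> interior (base \<Phi>)"
      using int t by simp
    then have "complex_of_real t \<in> U"
      using U(2) interior_subset by blast
    moreover have "\<bar>?g p - ?g q\<bar> = cmod (?D t) * \<bar>p - q\<bar>"
      using t(3) D(2)[OF t'] abs_mult[of "q - p" "Re (?D t)"] by (simp add: abs_minus_commute mult.commute)
    ultimately show ?thesis
      by blast
  qed
  have mvt: "\<exists>z\<in>U. \<bar>comp_word (gen \<Phi>) w p - comp_word (gen \<Phi>) w q\<bar>
      = cmod (deriv (comp_word f w) z) * \<bar>p - q\<bar>"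
    if w: "w \<in> words d n" and p: "p \<in> limit_set d \<Phi>" and q: "q \<in> limit_set d \<Phi>" for w n p q
  proof (cases p q rule: linorder_cases)
    case less
    show ?thesis
      by (rule main[OF w p q less])
  next
    case equal
    have "complex_of_real p \<in> U"
      using p limit_set_subset_base[OF assms] U(2) by blast
    with equal show ?thesis
      by auto
  next
    case greater
    show ?thesis
      using main[OF w q p greater] by (simp add: abs_minus_commute)
  qed
  show ?thesis
  proof (rule that[OF C])
    fix n w x p q
    assume w: "w \<in> words d n" and x: "x \<in> sstart {1..d} w"
      and p: "p \<in> limit_set d \<Phi>" and q: "q \<in> limit_set d \<Phi>"
    let ?g = "comp_word (gen \<Phi>) w" and ?z = "complex_of_real (coding \<Phi> (sdrop n x))"
    note x' = sstartD[OF x w]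
    have "?z \<in> U"
      using coding_in_limit_set[OF assms streams_sdrop[OF x'(1)]] limit_set_subset_base[OF assms] U(2)
      by blast
    have e: "exp (birkhoff_sum n (geom_potential \<Phi>) x) = cmod (deriv (comp_word f w) ?z)"
      using exp_birkhoff_sum_eq_derivative[OF ext assms x'(1), of n] x'(2) by simp
    obtain y where y: "y \<in> U" "\<bar>?g p - ?g q\<bar> = cmod (deriv (comp_word f w) y) * \<bar>p - q\<bar>"
      using mvt[OF w p q] by blast
    show "exp (birkhoff_sum n (geom_potential \<Phi>) x) * \<bar>p - q\<bar> \<le> C * \<bar>?g p - ?g q\<bar>"
      unfolding e y(2) mult.assoc[symmetric]
      by (intro mult_right_mono dist[OF w y(1) \<open>?z \<in> U\<close>]) simp
    show "\<bar>?g p - ?g q\<bar> \<le> C * (exp (birkhoff_sum n (geom_potential \<Phi>) x) * \<bar>p - q\<bar>)"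
      unfolding e y(2) mult.assoc[symmetric]
      by (intro mult_right_mono dist[OF w \<open>?z \<in> U\<close> y(1)]) simp
  qed
qed


section \<open>Rate vectors and bi-Lipschitz conjugacy\<close>

text \<open>
  A rate vector for systems that need not be affine: up to a constant that does not depend on the word,
  compositions act on the limit set like similarities with ratio \<open>weight r w\<close>. Only this coarse
  information enters the Gibbs bounds, and unlike the derivatives of the generators it is invariant
  under bi-Lipschitz conjugacy.
\<close>

definition similarity_rates :: "nat \<Rightarrow> ifs \<Rightarrow> (nat \<Rightarrow> real) \<Rightarrow> bool" where
  "similarity_rates d \<Phi> r \<longleftrightarrow> (\<forall>i\<in>{1..d}. 0 < r i) \<and>
     (\<exists>C\<ge>1. \<forall>n. \<forall>w\<in>words d n. \<forall>p\<in>limit_set d \<Phi>. \<forall>q\<in>limit_set d \<Phi>.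
        weight r w * \<bar>p - q\<bar> \<le> C * \<bar>comp_word (gen \<Phi>) w p - comp_word (gen \<Phi>) w q\<bar> \<and>
        \<bar>comp_word (gen \<Phi>) w p - comp_word (gen \<Phi>) w q\<bar> \<le> C * (weight r w * \<bar>p - q\<bar>))"

lemma similarity_ratesE:
  assumes "similarity_rates d \<Phi> r"
  obtains C where "C \<ge> 1"
    and "\<And>n w p q. w \<in> words d n \<Longrightarrow> p \<in> limit_set d \<Phi> \<Longrightarrow> q \<in> limit_set d \<Phi> \<Longrightarrow>
        weight r w * \<bar>p - q\<bar> \<le> C * \<bar>comp_word (gen \<Phi>) w p - comp_word (gen \<Phi>) w q\<bar>"
    and "\<And>n w p q. w \<in> words d n \<Longrightarrow> p \<in> limit_set d \<Phi> \<Longrightarrow> q \<in> limit_set d \<Phi> \<Longrightarrow>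
        \<bar>comp_word (gen \<Phi>) w p - comp_word (gen \<Phi>) w q\<bar> \<le> C * (weight r w * \<bar>p - q\<bar>)"
  using assms unfolding similarity_rates_def by blast

lemma similarity_rates_pos: "similarity_rates d \<Phi> r \<Longrightarrow> i \<in> {1..d} \<Longrightarrow> 0 < r i"
  by (simp add: similarity_rates_def)

text \<open>
  A two-sided estimate with a single constant, free of the inverse function, is easier to compose and
  to invert.
\<close>

lemma bi_lipschitz_bij_iff:
  "bi_lipschitz_bij h A B \<longleftrightarrow> bij_betw h A B \<and>
     (\<exists>L\<ge>1. \<forall>x\<in>A. \<forall>y\<in>A. \<bar>h x - h y\<bar> \<le> L * \<bar>x - y\<bar> \<and> \<bar>x - y\<bar> \<le> L * \<bar>h x - h y\<bar>)"
  (is "_ \<longleftrightarrow> _ \<and> (\<exists>L\<ge>1. ?P L)")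
proof safe
  assume "bi_lipschitz_bij h A B"
  then obtain L L' where bij: "bij_betw h A B" and L: "L-lipschitz_on A h"
    and L': "L'-lipschitz_on B (inv_into A h)"
    unfolding bi_lipschitz_bij_def by blast
  then show "bij_betw h A B"
    by simp
  let ?M = "max 1 (max L L')"
  have "?P ?M"
  proof (intro ballI conjI)
    fix x y assume x: "x \<in> A" and y: "y \<in> A"
    have "\<bar>h x - h y\<bar> \<le> L * \<bar>x - y\<bar>"
      using lipschitz_onD[OF L x y] by (simp add: dist_real_def)
    also have "\<dots> \<le> ?M * \<bar>x - y\<bar>"
      by (intro mult_right_mono) auto
    finally show "\<bar>h x - h y\<bar> \<le> ?M * \<bar>x - y\<bar>" .
    have "h x \<in> B" "h y \<in> B"
      using bij_betwE[OF bij] x y by auto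
    from lipschitz_onD[OF L' this] have "\<bar>x - y\<bar> \<le> L' * \<bar>h x - h y\<bar>"
      using bij_betw_inv_into_left[OF bij x] bij_betw_inv_into_left[OF bij y]
      by (simp add: dist_real_def)
    also have "\<dots> \<le> ?M * \<bar>h x - h y\<bar>"
      by (intro mult_right_mono) auto
    finally show "\<bar>x - y\<bar> \<le> ?M * \<bar>h x - h y\<bar>" .
  qed
  then show "\<exists>L\<ge>1. ?P L"
    by (intro exI[of _ ?M]) simp
next
  fix L :: real assume bij: "bij_betw h A B" and "1 \<le> L" and L: "?P L"
  have "L-lipschitz_on A h"
    using L \<open>1 \<le> L\<close> by (intro lipschitz_onI) (auto simp: dist_real_def)
  moreover have "L-lipschitz_on B (inv_into A h)"
  proof (rule lipschitz_onI)
    fix x y assume x: "x \<in> B" and y: "y \<in> B"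
    have "inv_into A h x \<in> A" "inv_into A h y \<in> A"
      using bij_betwE[OF bij_betw_inv_into[OF bij]] x y by auto
    then show "dist (inv_into A h x) (inv_into A h y) \<le> L * dist x y"
      using L bij_betw_inv_into_right[OF bij x] bij_betw_inv_into_right[OF bij y]
      by (metis dist_real_def)
  qed (use \<open>1 \<le> L\<close> in simp)
  ultimately show "bi_lipschitz_bij h A B"
    using bij unfolding bi_lipschitz_bij_def by blast
qed

lemma bi_lipschitz_bij_id: "bi_lipschitz_bij (\<lambda>x. x) A A"
  unfolding bi_lipschitz_bij_iff by (auto simp: bij_betw_def intro!: exI[of _ "1::real"])

lemma bi_lipschitz_bij_inv:
  assumes "bi_lipschitz_bij h A B"
  shows "bi_lipschitz_bij (inv_into A h) B A"
proof -
  obtain L where bij: "bij_betw h A B" and "L \<ge> 1"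
    and L: "\<And>x y. x \<in> A \<Longrightarrow> y \<in> A \<Longrightarrow> \<bar>h x - h y\<bar> \<le> L * \<bar>x - y\<bar> \<and> \<bar>x - y\<bar> \<le> L * \<bar>h x - h y\<bar>"
    using assms unfolding bi_lipschitz_bij_iff by blast
  show ?thesis
    unfolding bi_lipschitz_bij_iff
  proof (intro conjI exI[of _ L] ballI)
    show "bij_betw (inv_into A h) B A"
      by (rule bij_betw_inv_into[OF bij])
    fix x y assume x: "x \<in> B" and y: "y \<in> B"
    have "inv_into A h x \<in> A" "inv_into A h y \<in> A"
      using bij_betwE[OF bij_betw_inv_into[OF bij]] x y by auto
    from L[OF this] show "\<bar>inv_into A h x - inv_into A h y\<bar> \<le> L * \<bar>x - y\<bar>"
      "\<bar>x - y\<bar> \<le> L * \<bar>inv_into A h x - inv_into A h y\<bar>"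
      using bij_betw_inv_into_right[OF bij x] bij_betw_inv_into_right[OF bij y] by simp_all
  qed fact
qed

lemma bi_lipschitz_bij_comp:
  assumes "bi_lipschitz_bij h A B" "bi_lipschitz_bij k B D"
  shows "bi_lipschitz_bij (\<lambda>x. k (h x)) A D"
proof -
  obtain L where bij: "bij_betw h A B" and "L \<ge> 1"
    and L: "\<And>x y. x \<in> A \<Longrightarrow> y \<in> A \<Longrightarrow> \<bar>h x - h y\<bar> \<le> L * \<bar>x - y\<bar> \<and> \<bar>x - y\<bar> \<le> L * \<bar>h x - h y\<bar>"
    using assms(1) unfolding bi_lipschitz_bij_iff by blast
  obtain K where bij': "bij_betw k B D" and "K \<ge> 1"
    and K: "\<And>x y. x \<in> B \<Longrightarrow> y \<in> B \<Longrightarrow> \<bar>k x - k y\<bar> \<le> K * \<bar>x - y\<bar> \<and> \<bar>x - y\<bar> \<le> K * \<bar>k x - k y\<bar>"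
    using assms(2) unfolding bi_lipschitz_bij_iff by blast
  show ?thesis
    unfolding bi_lipschitz_bij_iff
  proof (intro conjI exI[of _ "K * L"] ballI)
    show "bij_betw (\<lambda>x. k (h x)) A D"
      using bij_betw_trans[OF bij bij'] by (simp add: comp_def)
    show "1 \<le> K * L"
      using mult_mono[of 1 K 1 L] \<open>L \<ge> 1\<close> \<open>K \<ge> 1\<close> by simp
    fix x y assume x: "x \<in> A" and y: "y \<in> A"
    have h: "h x \<in> B" "h y \<in> B"
      using bij_betwE[OF bij] x y by auto
    have "\<bar>k (h x) - k (h y)\<bar> \<le> K * \<bar>h x - h y\<bar>"
      using K[OF h] by simp
    also have "\<dots> \<le> K * (L * \<bar>x - y\<bar>)"
      using L[OF x y] \<open>K \<ge> 1\<close> by (intro mult_left_mono) auto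
    finally show "\<bar>k (h x) - k (h y)\<bar> \<le> K * L * \<bar>x - y\<bar>"
      by (simp only: mult.assoc)
    have "\<bar>x - y\<bar> \<le> L * \<bar>h x - h y\<bar>"
      using L[OF x y] by simp
    also have "\<dots> \<le> L * (K * \<bar>k (h x) - k (h y)\<bar>)"
      using K[OF h] \<open>L \<ge> 1\<close> by (intro mult_left_mono) auto
    finally show "\<bar>x - y\<bar> \<le> K * L * \<bar>k (h x) - k (h y)\<bar>"
      by (simp only: mult.assoc mult.left_commute)
  qed
qed

text \<open>
  The relation behind \<^term>\<open>sim\<close>, with the reordering \<open>\<tau>\<close> and the conjugacy \<open>h\<close> explicit: rate vectors
  are transported along \<open>\<tau>\<close>.
\<close>

definition conjugates :: "nat \<Rightarrow> (nat \<Rightarrow> nat) \<Rightarrow> (real \<Rightarrow> real) \<Rightarrow> ifs \<Rightarrow> ifs \<Rightarrow> bool" where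
  "conjugates d \<tau> h \<Phi> \<Psi> \<longleftrightarrow>
     \<tau> permutes {1..d} \<and> bi_lipschitz_bij h (limit_set d \<Phi>) (limit_set d \<Psi>) \<and>
     (\<forall>i\<in>{1..d}. \<forall>x\<in>limit_set d \<Phi>. gen \<Psi> (\<tau> i) (h x) = h (gen \<Phi> i x))"

lemma sim_iff_conjugates: "sim d \<Phi> \<Psi> \<longleftrightarrow> (\<exists>\<tau> h. conjugates d \<tau> h \<Phi> \<Psi>)"
  by (simp add: sim_def conjugates_def permute_gens_def)

lemma conjugates_D:
  assumes "conjugates d \<tau> h \<Phi> \<Psi>"
  shows "\<tau> permutes {1..d}" "bi_lipschitz_bij h (limit_set d \<Phi>) (limit_set d \<Psi>)"
    and "bij_betw h (limit_set d \<Phi>) (limit_set d \<Psi>)"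
    and "i \<in> {1..d} \<Longrightarrow> x \<in> limit_set d \<Phi> \<Longrightarrow> gen \<Psi> (\<tau> i) (h x) = h (gen \<Phi> i x)"
  using assms by (simp_all add: conjugates_def bi_lipschitz_bij_def)

lemma conjugates_word:
  assumes "CS d \<Phi>" "conjugates d \<tau> h \<Phi> \<Psi>" "w \<in> words d n" "x \<in> limit_set d \<Phi>"
  shows "h (comp_word (gen \<Phi>) w x) = comp_word (gen \<Psi>) (map \<tau> w) (h x)"
  using assms(3)
proof (induction w arbitrary: n)
  case (Cons a w)
  then have a: "a \<in> {1..d}" and w: "w \<in> words d (length w)"
    by (auto simp: words_def)
  show ?case
    using conjugates_D(4)[OF assms(2) a word_limit_set[OF assms(1) w assms(4)]] Cons.IH[OF w]
    by simp
qed simp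

lemma conjugates_refl: "conjugates d id (\<lambda>x. x) \<Phi> \<Phi>"
  unfolding conjugates_def using bi_lipschitz_bij_id by (simp add: permutes_id)

lemma conjugates_inv:
  assumes "CS d \<Phi>" and conj: "conjugates d \<tau> h \<Phi> \<Psi>"
  shows "conjugates d (inv \<tau>) (inv_into (limit_set d \<Phi>) h) \<Psi> \<Phi>"
  unfolding conjugates_def
proof (intro conjI ballI)
  note c = conjugates_D[OF conj]
  show "inv \<tau> permutes {1..d}"
    by (rule permutes_inv[OF c(1)])
  show "bi_lipschitz_bij (inv_into (limit_set d \<Phi>) h) (limit_set d \<Psi>) (limit_set d \<Phi>)"
    by (rule bi_lipschitz_bij_inv[OF c(2)])
  fix i y assume i: "i \<in> {1..d}" and y: "y \<in> limit_set d \<Psi>"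
  let ?j = "inv \<tau> i" and ?x = "inv_into (limit_set d \<Phi>) h y"
  have j: "?j \<in> {1..d}"
    using permutes_in_image[OF permutes_inv[OF c(1)]] i by blast
  have x: "?x \<in> limit_set d \<Phi>"
    using bij_betwE[OF bij_betw_inv_into[OF c(3)]] y by blast
  have "h (gen \<Phi> ?j ?x) = gen \<Psi> i y"
    using c(4)[OF j x] bij_betw_inv_into_right[OF c(3) y] permutes_inverses(1)[OF c(1)] by simp
  moreover have "gen \<Phi> ?j ?x \<in> limit_set d \<Phi>"
    using gen_limit_set[OF assms(1) j] x by blast
  ultimately show "gen \<Phi> ?j ?x = inv_into (limit_set d \<Phi>) h (gen \<Psi> i y)"
    using bij_betw_inv_into_left[OF c(3)] by metis
qed

lemma conjugates_comp:
  assumes "conjugates d \<tau> h \<Phi> \<Psi>" "conjugates d \<upsilon> k \<Psi> \<Omega>"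
  shows "conjugates d (\<upsilon> \<circ> \<tau>) (\<lambda>x. k (h x)) \<Phi> \<Omega>"
  unfolding conjugates_def
proof (intro conjI ballI)
  note c = conjugates_D[OF assms(1)] and e = conjugates_D[OF assms(2)]
  show "\<upsilon> \<circ> \<tau> permutes {1..d}"
    by (rule permutes_compose[OF c(1) e(1)])
  show "bi_lipschitz_bij (\<lambda>x. k (h x)) (limit_set d \<Phi>) (limit_set d \<Omega>)"
    by (rule bi_lipschitz_bij_comp[OF c(2) e(2)])
  fix i x assume i: "i \<in> {1..d}" and x: "x \<in> limit_set d \<Phi>"
  have "\<tau> i \<in> {1..d}"
    using permutes_in_image[OF c(1)] i by blast
  moreover have "h x \<in> limit_set d \<Psi>"
    using bij_betwE[OF c(3)] x by blast
  ultimately show "gen \<Omega> ((\<upsilon> \<circ> \<tau>) i) (k (h x)) = k (h (gen \<Phi> i x))"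
    using c(4)[OF i x] e(4) by simp
qed

lemma weight_map: "weight r (map \<tau> w) = weight (\<lambda>i. r (\<tau> i)) w"
  by (induction w) auto

lemma similarity_rates_transport:
  assumes "CS d \<Phi>" and conj: "conjugates d \<tau> h \<Phi> \<Psi>" and rates: "similarity_rates d \<Psi> r"
  shows "similarity_rates d \<Phi> (\<lambda>i. r (\<tau> i))"
proof -
  note c = conjugates_D[OF conj]
  obtain L where L: "L \<ge> 1" "\<And>x y. x \<in> limit_set d \<Phi> \<Longrightarrow> y \<in> limit_set d \<Phi> \<Longrightarrow>
      \<bar>h x - h y\<bar> \<le> L * \<bar>x - y\<bar>" "\<And>x y. x \<in> limit_set d \<Phi> \<Longrightarrow> y \<in> limit_set d \<Phi> \<Longrightarrow>
      \<bar>x - y\<bar> \<le> L * \<bar>h x - h y\<bar>"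
    using c(2) unfolding bi_lipschitz_bij_iff by blast
  obtain C where C: "C \<ge> 1"
    "\<And>n w p q. w \<in> words d n \<Longrightarrow> p \<in> limit_set d \<Psi> \<Longrightarrow> q \<in> limit_set d \<Psi> \<Longrightarrow>
        weight r w * \<bar>p - q\<bar> \<le> C * \<bar>comp_word (gen \<Psi>) w p - comp_word (gen \<Psi>) w q\<bar>"
    "\<And>n w p q. w \<in> words d n \<Longrightarrow> p \<in> limit_set d \<Psi> \<Longrightarrow> q \<in> limit_set d \<Psi> \<Longrightarrow>
        \<bar>comp_word (gen \<Psi>) w p - comp_word (gen \<Psi>) w q\<bar> \<le> C * (weight r w * \<bar>p - q\<bar>)"
    using similarity_ratesE[OF rates] by blast
  have pos: "0 < r (\<tau> i)" if "i \<in> {1..d}" for i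
    using similarity_rates_pos[OF rates] permutes_in_image[OF c(1)] that by blast
  let ?C = "L * (C * L)"
  show ?thesis
    unfolding similarity_rates_def
  proof (intro conjI exI[of _ ?C] allI ballI)
    show "1 \<le> ?C"
      using C(1) L(1) mult_mono[of 1 C 1 L] mult_mono[of 1 L 1 "C * L"] by simp
    fix n w p q assume w: "w \<in> words d n" and p: "p \<in> limit_set d \<Phi>" and q: "q \<in> limit_set d \<Phi>"
    let ?p = "comp_word (gen \<Phi>) w p" and ?q = "comp_word (gen \<Phi>) w q"
    let ?W = "weight (\<lambda>i. r (\<tau> i)) w"
    have W: "0 \<le> ?W"
      using weight_pos[of d "\<lambda>i. r (\<tau> i)", OF pos w] by simp
    have hpq: "h p \<in> limit_set d \<Psi>" "h q \<in> limit_set d \<Psi>"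
      using bij_betwE[OF c(3)] p q by auto
    note pq' = word_limit_set[OF assms(1) w p] word_limit_set[OF assms(1) w q]
    have low: "?W * \<bar>h p - h q\<bar> \<le> C * \<bar>h ?p - h ?q\<bar>"
      and upp: "\<bar>h ?p - h ?q\<bar> \<le> C * (?W * \<bar>h p - h q\<bar>)"
      using C(2,3)[OF words_map[OF c(1) w] hpq]
      by (simp_all add: weight_map conjugates_word[OF assms(1) conj w] p q)
    have "?W * \<bar>p - q\<bar> \<le> ?W * (L * \<bar>h p - h q\<bar>)"
      by (intro mult_left_mono L(3) p q W)
    also have "\<dots> = L * (?W * \<bar>h p - h q\<bar>)"
      by simp
    also have "\<dots> \<le> L * (C * \<bar>h ?p - h ?q\<bar>)"
      using low L(1) by (intro mult_left_mono) auto
    also have "\<dots> \<le> L * (C * (L * \<bar>?p - ?q\<bar>))"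
      using L(1) C(1) by (intro mult_left_mono L(2) pq') auto
    finally show "?W * \<bar>p - q\<bar> \<le> ?C * \<bar>?p - ?q\<bar>"
      by (simp only: mult.assoc)
    have "\<bar>?p - ?q\<bar> \<le> L * \<bar>h ?p - h ?q\<bar>"
      by (rule L(3)[OF pq'])
    also have "\<dots> \<le> L * (C * (?W * \<bar>h p - h q\<bar>))"
      using upp L(1) by (intro mult_left_mono) auto
    also have "\<dots> \<le> L * (C * (?W * (L * \<bar>p - q\<bar>)))"
      using L(1) C(1) W by (intro mult_left_mono L(2) p q) auto
    finally show "\<bar>?p - ?q\<bar> \<le> ?C * (?W * \<bar>p - q\<bar>)"
      by (simp only: mult.assoc mult.left_commute)
  qed (use pos in auto)
qed

lemma permute_gens_sel [simp]:
  "base (permute_gens \<tau> \<Phi>) = base \<Phi>" "gen (permute_gens \<tau> \<Phi>) i = gen \<Phi> (\<tau> i)"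
  by (simp_all add: permute_gens_def)

lemma words_permuted:
  assumes "\<tau> permutes {1..d}"
  shows "map \<tau> ` words d n = words d n"
proof (rule subset_antisym)
  show "map \<tau> ` words d n \<subseteq> words d n"
    using words_map[OF assms] by blast
  show "words d n \<subseteq> map \<tau> ` words d n"
  proof
    fix w assume w: "w \<in> words d n"
    have "w = map \<tau> (map (inv \<tau>) w)"
      by (simp add: permutes_inverses(1)[OF assms] map_idI)
    then show "w \<in> map \<tau> ` words d n"
      using words_map[OF permutes_inv[OF assms] w] by blast
  qed
qed

lemma limit_set_permute_gens:
  assumes "\<tau> permutes {1..d}"
  shows "limit_set d (permute_gens \<tau> \<Phi>) = limit_set d \<Phi>"
proof -
  have "comp_word (gen (permute_gens \<tau> \<Phi>)) w = comp_word (gen \<Phi>) (map \<tau> w)" for w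
    by (rule ext) (simp add: comp_word_map permute_gens_def)
  then have "(\<Union>w\<in>words d n. comp_word (gen (permute_gens \<tau> \<Phi>)) w ` base \<Phi>)
      = (\<Union>w\<in>map \<tau> ` words d n. comp_word (gen \<Phi>) w ` base \<Phi>)" for n
    by simp
  then show ?thesis
    unfolding limit_set_def words_permuted[OF assms] by simp
qed

lemma CS_permute_gens:
  assumes "CS d \<Phi>" "\<tau> permutes {1..d}"
  shows "CS d (permute_gens \<tau> \<Phi>)"
proof -
  have \<tau>: "\<tau> i \<in> {1..d}" if "i \<in> {1..d}" for i
    using permutes_in_image[OF assms(2)] that by blast
  have inj: "\<tau> i \<noteq> \<tau> j" if "i \<noteq> j" for i j
    using permutes_inj[OF assms(2)] that by (auto dest: injD)
  obtain U f where f: "conformal_ext d \<Phi> U f" "bounded_distortion d U f"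
    using CS_D(9)[OF assms(1)] by blast
  have "conformal_ext d (permute_gens \<tau> \<Phi>) U (\<lambda>i. f (\<tau> i))"
    using f(1) \<tau> unfolding conformal_ext_def by simp
  moreover have "bounded_distortion d U (\<lambda>i. f (\<tau> i))"
    unfolding bounded_distortion_def
  proof -
    obtain C where C: "C \<ge> 1" "\<And>n w x y. w \<in> words d n \<Longrightarrow> x \<in> U \<Longrightarrow> y \<in> U \<Longrightarrow>
        cmod (deriv (comp_word f w) y) \<le> C * cmod (deriv (comp_word f w) x)"
      using f(2) unfolding bounded_distortion_def by blast
    have "comp_word (\<lambda>i. f (\<tau> i)) w = comp_word f (map \<tau> w)" for w
      by (rule ext) (rule comp_word_map[symmetric])
    then show "\<exists>C\<ge>1. \<forall>n. \<forall>w\<in>words d n. \<forall>x\<in>U. \<forall>y\<in>U.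
        cmod (deriv (comp_word (\<lambda>i. f (\<tau> i)) w) y) \<le> C * cmod (deriv (comp_word (\<lambda>i. f (\<tau> i)) w) x)"
      using C(2)[OF words_map[OF assms(2)]] C(1) by (intro exI[of _ C]) simp
  qed
  ultimately have "\<exists>U f. conformal_ext d (permute_gens \<tau> \<Phi>) U f \<and> bounded_distortion d U f"
    by blast
  moreover have "gen \<Phi> (\<tau> i) ` interior (base \<Phi>) \<subseteq> interior (base \<Phi>)" if "i \<in> {1..d}" for i
    using subset_trans[OF image_mono[OF interior_subset] CS_D(4)[OF assms(1) \<tau>[OF that]]] .
  moreover have "gen \<Phi> (\<tau> i) ` interior (base \<Phi>) \<inter> gen \<Phi> (\<tau> j) ` interior (base \<Phi>) = {}"
    if "i \<in> {1..d}" "j \<in> {1..d}" "i \<noteq> j" for i j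
    using CS_D(7)[OF assms(1) \<tau>[OF that(1)] \<tau>[OF that(2)] inj[OF that(3)]] .
  ultimately show ?thesis
    unfolding CS_def permute_gens_sel
    by (intro conjI ballI impI CS_D(1-3)[OF assms(1)] CS_D(4,6,8)[OF assms(1) \<tau>])
qed

lemma conjugates_permute_gens:
  assumes "\<tau> permutes {1..d}"
  shows "conjugates d \<tau> (\<lambda>x. x) (permute_gens \<tau> \<Phi>) \<Phi>"
  using assms bi_lipschitz_bij_id by (simp add: conjugates_def limit_set_permute_gens)

lemma similarity_rates_permute_gens:
  assumes "CS d \<Phi>" "\<tau> permutes {1..d}" "similarity_rates d \<Phi> r"
  shows "similarity_rates d (permute_gens \<tau> \<Phi>) (\<lambda>i. r (\<tau> i))"
  by (rule similarity_rates_transport[OF CS_permute_gens[OF assms(1,2)]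
        conjugates_permute_gens[OF assms(2)] assms(3)])


section \<open>Affine systems\<close>

lemma AS_slope:
  assumes "AS d \<Phi>" "d \<ge> 2" "i \<in> {1..d}"
  obtains a b where "a \<noteq> 0" "\<And>x. x \<in> base \<Phi> \<Longrightarrow> gen \<Phi> i x = a * x + b"
    and "\<And>x. x \<in> interior (base \<Phi>) \<Longrightarrow> deriv (gen \<Phi> i) x = a"
proof -
  have CS: "CS d \<Phi>"
    using assms(1) by (simp add: AS_def)
  obtain a b where ab: "\<And>x. x \<in> base \<Phi> \<Longrightarrow> gen \<Phi> i x = a * x + b"
    using assms(1,3) unfolding AS_def by blast
  obtain p q where limit: "p \<in> limit_set d \<Phi>" "q \<in> limit_set d \<Phi>" and "p \<noteq> q"
    using limit_set_two_points[OF CS assms(2)] .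
  then have pq: "p \<in> base \<Phi>" "q \<in> base \<Phi>" "p \<noteq> q"
    using limit_set_subset_base[OF CS] by auto
  have "a \<noteq> 0"
  proof
    assume "a = 0"
    then have "gen \<Phi> i p = gen \<Phi> i q"
      using ab pq by simp
    then show False
      using inj_onD[OF CS_D(6)[OF CS assms(3)]] pq by blast
  qed
  moreover have "deriv (gen \<Phi> i) x = a" if x: "x \<in> interior (base \<Phi>)" for x
  proof -
    have "((\<lambda>x. a * x + b) has_field_derivative a) (at x)"
      by (auto intro!: derivative_eq_intros)
    then have "(gen \<Phi> i has_field_derivative a) (at x)"
      by (rule has_field_derivative_transform_within_open[OF _ open_interior x])
         (use ab interior_subset[of "base \<Phi>"] in auto)
    then show ?thesis
      by (rule DERIV_imp_deriv)
  qed
  ultimately show ?thesis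
    using that ab by blast
qed

lemma AS_interior_nonempty:
  assumes "AS d \<Phi>" "d \<ge> 2"
  shows "interior (base \<Phi>) \<noteq> {}"
proof -
  have CS: "CS d \<Phi>"
    using assms(1) by (simp add: AS_def)
  obtain p where "p \<in> limit_set d \<Phi>"
    using limit_set_two_points[OF CS assms(2)] .
  then show ?thesis
    using limit_set_subset_interior[OF CS] by blast
qed

text \<open>
  The contraction rate vector of a single affine system; \<^term>\<open>contraction_rates\<close> asks for a member of
  the class with this vector.
\<close>

definition slope_sizes :: "nat \<Rightarrow> ifs \<Rightarrow> (nat \<Rightarrow> real) \<Rightarrow> bool" where
  "slope_sizes d \<Phi> r \<longleftrightarrow> AS d \<Phi> \<and> (\<forall>i\<in>{1..d}. \<forall>x\<in>interior (base \<Phi>). r i = \<bar>deriv (gen \<Phi> i) x\<bar>)"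

lemma slope_sizes_D:
  assumes "slope_sizes d \<Phi> r" "d \<ge> 2" "i \<in> {1..d}"
  shows "0 < r i"
    and "\<exists>a b. r i = \<bar>a\<bar> \<and> a \<noteq> 0 \<and> (\<forall>x\<in>base \<Phi>. gen \<Phi> i x = a * x + b)"
proof -
  have AS: "AS d \<Phi>"
    using assms(1) by (simp add: slope_sizes_def)
  obtain a b where ab: "a \<noteq> 0" "\<And>x. x \<in> base \<Phi> \<Longrightarrow> gen \<Phi> i x = a * x + b"
    "\<And>x. x \<in> interior (base \<Phi>) \<Longrightarrow> deriv (gen \<Phi> i) x = a"
    using AS_slope[OF AS assms(2,3)] by blast
  obtain x where "x \<in> interior (base \<Phi>)"
    using AS_interior_nonempty[OF AS assms(2)] by blast
  then have "r i = \<bar>a\<bar>"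
    using assms(1,3) ab(3) by (simp add: slope_sizes_def)
  with ab show "0 < r i"
    and "\<exists>a b. r i = \<bar>a\<bar> \<and> a \<noteq> 0 \<and> (\<forall>x\<in>base \<Phi>. gen \<Phi> i x = a * x + b)"
    by auto
qed

lemma slope_sizes_exist:
  assumes "AS d \<Phi>" "d \<ge> 2"
  obtains r where "slope_sizes d \<Phi> r"
proof -
  obtain x0 where x0: "x0 \<in> interior (base \<Phi>)"
    using AS_interior_nonempty[OF assms] by blast
  have "\<bar>deriv (gen \<Phi> i) x0\<bar> = \<bar>deriv (gen \<Phi> i) x\<bar>"
    if "i \<in> {1..d}" "x \<in> interior (base \<Phi>)" for i x
    using AS_slope[OF assms that(1)] x0 that(2) by metis
  then have "slope_sizes d \<Phi> (\<lambda>i. \<bar>deriv (gen \<Phi> i) x0\<bar>)"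
    using assms(1) by (simp add: slope_sizes_def)
  then show ?thesis
    by (rule that)
qed

lemma slope_sizes_similarity:
  assumes "slope_sizes d \<Phi> r" "d \<ge> 2"
  shows "similarity_rates d \<Phi> r"
proof -
  have CS: "CS d \<Phi>"
    using assms(1) by (simp add: slope_sizes_def AS_def)
  have step: "\<bar>gen \<Phi> i x - gen \<Phi> i y\<bar> = r i * \<bar>x - y\<bar>"
    if i: "i \<in> {1..d}" and xy: "x \<in> base \<Phi>" "y \<in> base \<Phi>" for i x y
  proof -
    obtain a b where ab: "r i = \<bar>a\<bar>" "\<And>x. x \<in> base \<Phi> \<Longrightarrow> gen \<Phi> i x = a * x + b"
      using slope_sizes_D(2)[OF assms i] by blast
    have "gen \<Phi> i x - gen \<Phi> i y = a * (x - y)"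
      using ab(2) xy by (simp add: algebra_simps)
    then show ?thesis
      by (simp add: ab(1) abs_mult)
  qed
  have "\<bar>comp_word (gen \<Phi>) w p - comp_word (gen \<Phi>) w q\<bar> = weight r w * \<bar>p - q\<bar>"
    if "w \<in> words d n" and pq: "p \<in> base \<Phi>" "q \<in> base \<Phi>" for n w p q
    using that(1)
  proof (induction w arbitrary: n)
    case (Cons a w)
    then have a: "a \<in> {1..d}" and w: "w \<in> words d (length w)"
      by (auto simp: words_def)
    show ?case
      using step[OF a CS_word_in_base[OF CS w pq(1)] CS_word_in_base[OF CS w pq(2)]] Cons.IH[OF w]
      by (simp add: mult.assoc)
  qed simp
  then show ?thesis
    unfolding similarity_rates_def
    using slope_sizes_D(1)[OF assms] limit_set_subset_base[OF CS]
    by (intro conjI exI[of _ 1] allI ballI) (auto simp: subset_iff)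
qed

text \<open>
  The generators map the interior \<open>J\<close> of the base to disjoint subsets of \<open>J\<close>, the \<open>i\<close>-th of length \<open>r i\<close> times
  the length of \<open>J\<close>.
\<close>

lemma slope_sizes_sum_le_1:
  assumes "slope_sizes d \<Phi> r" "d \<ge> 2"
  shows "(\<Sum>i\<in>{1..d}. r i) \<le> 1"
proof -
  let ?J = "interior (base \<Phi>)" and ?f = "\<lambda>i. gen \<Phi> i ` interior (base \<Phi>)"
  have AS: "AS d \<Phi>" and CS: "CS d \<Phi>"
    using assms(1) by (simp_all add: slope_sizes_def AS_def)
  have "bounded (base \<Phi>)"
    using CS_D(1)[OF CS] by (rule compact_imp_bounded)
  then have J: "?J \<in> lmeasurable"
    by (rule lmeasurable_interior)
  have sub: "?f i \<subseteq> ?J" if "i \<in> {1..d}" for i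
    using subset_trans[OF image_mono[OF interior_subset] CS_D(4)[OF CS that]] .
  have image: "?f i \<in> lmeasurable \<and> measure lebesgue (?f i) = r i * measure lebesgue ?J"
    if i: "i \<in> {1..d}" for i
  proof -
    obtain a b where ab: "r i = \<bar>a\<bar>" "a \<noteq> 0" "\<And>x. x \<in> base \<Phi> \<Longrightarrow> gen \<Phi> i x = a * x + b"
      using slope_sizes_D(2)[OF assms i] by blast
    have eq: "?f i = (\<lambda>x. a *\<^sub>R x + b) ` ?J"
      using ab(3) interior_subset by (intro image_cong) auto
    have "open (?f i)"
      using open_affinity[OF open_interior ab(2), of b "base \<Phi>"]
      unfolding eq by (simp add: add.commute)
    moreover have "bounded (?f i)"
      using bounded_subset[OF \<open>bounded (base \<Phi>)\<close>] sub[OF i] interior_subset by (metis subset_trans)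
    ultimately have "?f i \<in> lmeasurable"
      by (intro lmeasurable_open)
    moreover have "measure lebesgue (?f i) = r i * measure lebesgue ?J"
      unfolding eq ab(1) using measure_lebesgue_affine[of a b ?J] by simp
    ultimately show ?thesis
      by simp
  qed
  have "(\<Sum>i\<in>{1..d}. r i) * measure lebesgue ?J = (\<Sum>i\<in>{1..d}. measure lebesgue (?f i))"
    by (simp add: sum_distrib_right image)
  also have "\<dots> = measure lebesgue (\<Union>(?f ` {1..d}))"
  proof (rule measure_negligible_finite_Union_image[symmetric])
    show "pairwise (\<lambda>i j. negligible (?f i \<inter> ?f j)) {1..d}"
      using CS_D(7)[OF CS] by (auto simp: pairwise_def)
  qed (use image in auto)
  also have "\<dots> \<le> measure lebesgue ?J"
  proof (rule measure_mono_fmeasurable)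
    show "\<Union>(?f ` {1..d}) \<subseteq> ?J"
      using sub by blast
    show "\<Union>(?f ` {1..d}) \<in> sets lebesgue"
      using image by (intro sets.finite_UN) (auto dest: fmeasurableD)
  qed (rule J)
  finally have "(\<Sum>i\<in>{1..d}. r i) * measure lebesgue ?J \<le> 1 * measure lebesgue ?J"
    by simp
  moreover have "0 < measure lebesgue ?J"
    using open_not_negligible[OF open_interior AS_interior_nonempty[OF AS assms(2)]]
      negligible_iff_measure[of ?J] J by (simp add: zero_less_measure_iff)
  ultimately show ?thesis
    by (rule mult_right_le_imp_le)
qed

lemma slope_sizes_permute_gens:
  assumes "slope_sizes d \<Phi> r" "\<tau> permutes {1..d}"
  shows "slope_sizes d (permute_gens \<tau> \<Phi>) (\<lambda>i. r (\<tau> i))"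
proof -
  have \<tau>: "\<tau> i \<in> {1..d}" if "i \<in> {1..d}" for i
    using permutes_in_image[OF assms(2)] that by blast
  have "AS d (permute_gens \<tau> \<Phi>)"
    using assms CS_permute_gens[OF _ assms(2), of \<Phi>] \<tau> by (simp add: slope_sizes_def AS_def)
  then show ?thesis
    using assms(1) \<tau> by (simp add: slope_sizes_def)
qed


section \<open>Gibbs measures are Bernoulli\<close>

text \<open>
  Both the weight of \<open>w\<close> and the exponential of the Birkhoff sum are comparable to the distance
  between the images of two fixed points of the limit set.
\<close>

lemma potential_near_log_weight:
  assumes "CS d \<Phi>" "d \<ge> 2" and rates: "similarity_rates d \<Phi> r"
  obtains B where "B \<ge> 0"
    and "\<And>n w x. w \<in> words d n \<Longrightarrow> x \<in> sstart {1..d} w \<Longrightarrow>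
          \<bar>birkhoff_sum n (geom_potential \<Phi>) x - ln (weight r w)\<bar> \<le> B"
proof -
  obtain p q where pq: "p \<in> limit_set d \<Phi>" "q \<in> limit_set d \<Phi>" "p \<noteq> q"
    using limit_set_two_points[OF assms(1,2)] .
  obtain C where C: "C \<ge> 1"
    "\<And>n w x p q. w \<in> words d n \<Longrightarrow> x \<in> sstart {1..d} w \<Longrightarrow>
          p \<in> limit_set d \<Phi> \<Longrightarrow> q \<in> limit_set d \<Phi> \<Longrightarrow>
          exp (birkhoff_sum n (geom_potential \<Phi>) x) * \<bar>p - q\<bar>
            \<le> C * \<bar>comp_word (gen \<Phi>) w p - comp_word (gen \<Phi>) w q\<bar>"
    "\<And>n w x p q. w \<in> words d n \<Longrightarrow> x \<in> sstart {1..d} w \<Longrightarrow>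
          p \<in> limit_set d \<Phi> \<Longrightarrow> q \<in> limit_set d \<Phi> \<Longrightarrow>
          \<bar>comp_word (gen \<Phi>) w p - comp_word (gen \<Phi>) w q\<bar>
            \<le> C * (exp (birkhoff_sum n (geom_potential \<Phi>) x) * \<bar>p - q\<bar>)"
    using distances_comparable_to_potential[OF assms(1)] by blast
  obtain D where D: "D \<ge> 1"
    "\<And>n w p q. w \<in> words d n \<Longrightarrow> p \<in> limit_set d \<Phi> \<Longrightarrow> q \<in> limit_set d \<Phi> \<Longrightarrow>
        weight r w * \<bar>p - q\<bar> \<le> D * \<bar>comp_word (gen \<Phi>) w p - comp_word (gen \<Phi>) w q\<bar>"
    "\<And>n w p q. w \<in> words d n \<Longrightarrow> p \<in> limit_set d \<Phi> \<Longrightarrow> q \<in> limit_set d \<Phi> \<Longrightarrow>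
        \<bar>comp_word (gen \<Phi>) w p - comp_word (gen \<Phi>) w q\<bar> \<le> D * (weight r w * \<bar>p - q\<bar>)"
    using similarity_ratesE[OF rates] by blast
  show ?thesis
  proof (rule that[of "ln (C * D)"])
    have CD: "1 \<le> C * D"
      using mult_mono[of 1 C 1 D] C(1) D(1) by simp
    then show "0 \<le> ln (C * D)"
      by simp
    fix n w x assume w: "w \<in> words d n" and x: "x \<in> sstart {1..d} w"
    let ?S = "birkhoff_sum n (geom_potential \<Phi>) x"
      and ?g = "\<bar>comp_word (gen \<Phi>) w p - comp_word (gen \<Phi>) w q\<bar>"
    have W: "0 < weight r w"
      using weight_pos[of d r, OF similarity_rates_pos[OF rates] w] by simp
    have "exp ?S * \<bar>p - q\<bar> \<le> C * ?g"
      by (rule C(2)[OF w x pq(1,2)])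
    also have "\<dots> \<le> C * (D * (weight r w * \<bar>p - q\<bar>))"
      using C(1) by (intro mult_left_mono D(3)[OF w pq(1,2)]) simp
    finally have "exp ?S * \<bar>p - q\<bar> \<le> ((C * D) * weight r w) * \<bar>p - q\<bar>"
      by (simp only: mult.assoc)
    then have upper: "exp ?S \<le> (C * D) * weight r w"
      by (rule mult_right_le_imp_le) (use pq(3) in simp)
    have "weight r w * \<bar>p - q\<bar> \<le> D * ?g"
      by (rule D(2)[OF w pq(1,2)])
    also have "\<dots> \<le> D * (C * (exp ?S * \<bar>p - q\<bar>))"
      using D(1) by (intro mult_left_mono C(3)[OF w x pq(1,2)]) simp
    finally have "weight r w * \<bar>p - q\<bar> \<le> ((C * D) * exp ?S) * \<bar>p - q\<bar>"
      by (simp only: mult.assoc mult.left_commute)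
    then have lower: "weight r w \<le> (C * D) * exp ?S"
      by (rule mult_right_le_imp_le) (use pq(3) in simp)
    have "ln (exp ?S) \<le> ln ((C * D) * weight r w)"
      using upper W CD by (subst ln_le_cancel_iff) auto
    then have "?S \<le> ln (C * D) + ln (weight r w)"
      using W CD ln_mult_pos[of "C * D" "weight r w"] by simp
    moreover have "ln (weight r w) \<le> ln ((C * D) * exp ?S)"
      using lower W CD by (subst ln_le_cancel_iff) auto
    then have "ln (weight r w) \<le> ln (C * D) + ?S"
      using CD ln_mult_pos[of "C * D" "exp ?S"] by simp
    ultimately show "\<bar>?S - ln (weight r w)\<bar> \<le> ln (C * D)"
      by simp
  qed
qed

lemma birkhoff_sum_scale: "birkhoff_sum n (\<lambda>x. u * f x) x = u * birkhoff_sum n f x"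
  by (simp add: birkhoff_sum_def sum_distrib_left)

lemma weight_powr:
  assumes "\<And>i. i \<in> {1..d} \<Longrightarrow> 0 < r i" "w \<in> words d n"
  shows "weight (\<lambda>i. r i powr u) w = exp (u * ln (weight r w))"
  using weight_normalised[of d r w n u 1, OF assms] weight_pos[of d r, OF assms]
  by (simp add: powr_def)

lemma sum_powr_pos:
  fixes u :: real and r :: "nat \<Rightarrow> real"
  assumes "\<And>i. i \<in> {1..d} \<Longrightarrow> 0 < r i" "d \<ge> 1"
  shows "0 < (\<Sum>j\<in>{1..d}. r j powr u)"
proof (rule sum_pos)
  show "0 < r i powr u" if "i \<in> {1..d}" for i
    using assms(1)[OF that] by simp
qed (use assms(2) in auto)

text \<open>
  For the locally constant potential \<open>ln r\<close> the sum over words of length \<open>n\<close> is exactly \<open>Z ^ n\<close>. A bounded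
  error in the Birkhoff sums changes it by a bounded factor, which the division by \<open>n\<close> removes in the
  limit.
\<close>

lemma geom_pressure_eq:
  assumes "CS d \<Phi>" "d \<ge> 2" and rates: "similarity_rates d \<Phi> r"
  shows "geom_pressure d \<Phi> u = ln (\<Sum>i\<in>{1..d}. r i powr u)"
proof -
  obtain B where B: "B \<ge> 0" "\<And>n w x. w \<in> words d n \<Longrightarrow> x \<in> sstart {1..d} w \<Longrightarrow>
          \<bar>birkhoff_sum n (geom_potential \<Phi>) x - ln (weight r w)\<bar> \<le> B"
    using potential_near_log_weight[OF assms] by blast
  define Z where "Z = (\<Sum>i\<in>{1..d}. r i powr u)"
  define K where "K = \<bar>u\<bar> * B"
  define f where "f x = u * geom_potential \<Phi> x" for x
  define P where "P n = (\<Sum>w\<in>words d n. exp (SUP x\<in>sstart {1..d} w. birkhoff_sum n f x))" for n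
  note pos = similarity_rates_pos[OF rates]
  have Z: "0 < Z"
    unfolding Z_def using sum_powr_pos[of d r, OF pos] assms(2) by simp
  have near: "\<bar>birkhoff_sum n f x - u * ln (weight r w)\<bar> \<le> K"
    if "w \<in> words d n" "x \<in> sstart {1..d} w" for n w x
  proof -
    have "\<bar>birkhoff_sum n f x - u * ln (weight r w)\<bar>
        = \<bar>u\<bar> * \<bar>birkhoff_sum n (geom_potential \<Phi>) x - ln (weight r w)\<bar>"
      unfolding f_def birkhoff_sum_scale by (simp add: abs_mult[symmetric] right_diff_distrib)
    also have "\<dots> \<le> K"
      unfolding K_def by (intro mult_left_mono B(2)[OF that]) simp
    finally show ?thesis .
  qed
  have sup: "u * ln (weight r w) - K \<le> (SUP x\<in>sstart {1..d} w. birkhoff_sum n f x)"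
    "(SUP x\<in>sstart {1..d} w. birkhoff_sum n f x) \<le> u * ln (weight r w) + K"
    if w: "w \<in> words d n" for n w
  proof -
    have ne: "sstart {1..d} w \<noteq> {}"
      using sstart_nonempty[OF w] assms(2) by simp
    have le: "birkhoff_sum n f x \<le> u * ln (weight r w) + K" if "x \<in> sstart {1..d} w" for x
      using near[OF w that] by linarith
    then show "(SUP x\<in>sstart {1..d} w. birkhoff_sum n f x) \<le> u * ln (weight r w) + K"
      by (intro cSUP_least ne)
    obtain x where x: "x \<in> sstart {1..d} w"
      using ne by blast
    have "birkhoff_sum n f x \<le> (SUP x\<in>sstart {1..d} w. birkhoff_sum n f x)"
      by (rule cSUP_upper[OF x]) (use le in \<open>auto intro!: bdd_aboveI2\<close>)
    then show "u * ln (weight r w) - K \<le> (SUP x\<in>sstart {1..d} w. birkhoff_sum n f x)"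
      using near[OF w x] by linarith
  qed
  have total: "(\<Sum>w\<in>words d n. exp (u * ln (weight r w))) = Z ^ n" for n
    unfolding Z_def sum_words_weight[symmetric]
    by (intro sum.cong refl weight_powr[symmetric] pos)
  have lower: "exp (- K) * Z ^ n \<le> P n" for n
  proof -
    have "exp (- K) * Z ^ n = (\<Sum>w\<in>words d n. exp (u * ln (weight r w) - K))"
      unfolding total[symmetric] sum_distrib_left by (intro sum.cong refl) (simp add: exp_add[symmetric])
    also have "\<dots> \<le> P n"
      unfolding P_def by (intro sum_mono) (simp add: sup(1))
    finally show ?thesis .
  qed
  have upper: "P n \<le> exp K * Z ^ n" for n
  proof -
    have "P n \<le> (\<Sum>w\<in>words d n. exp (u * ln (weight r w) + K))"
      unfolding P_def by (intro sum_mono) (simp add: sup(2))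
    also have "\<dots> = exp K * Z ^ n"
      unfolding total[symmetric] sum_distrib_left by (intro sum.cong refl) (simp add: exp_add[symmetric] add.commute)
    finally show ?thesis .
  qed
  have bounds: "- K + real n * ln Z \<le> ln (P n)" "ln (P n) \<le> K + real n * ln Z" for n
  proof -
    have "0 < exp (- K) * Z ^ n"
      using Z by simp
    then have P: "0 < P n"
      using lower[of n] by linarith
    have "ln (exp (- K) * Z ^ n) \<le> ln (P n)"
      using lower[of n] P Z by (subst ln_le_cancel_iff) auto
    then show "- K + real n * ln Z \<le> ln (P n)"
      using Z by (simp add: ln_mult_pos ln_realpow)
    have "ln (P n) \<le> ln (exp K * Z ^ n)"
      using upper[of n] P Z by (subst ln_le_cancel_iff) auto
    then show "ln (P n) \<le> K + real n * ln Z"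
      using Z by (simp add: ln_mult_pos ln_realpow)
  qed
  have "(\<lambda>n. ln (P n) / real n) \<longlonglongrightarrow> ln Z"
  proof (rule tendsto_sandwich)
    have *: "(\<lambda>n. k / real n + ln Z) \<longlonglongrightarrow> ln Z" for k
      using tendsto_add[OF lim_const_over_n[of k] tendsto_const[of "ln Z"]] by simp
    show "(\<lambda>n. - K / real n + ln Z) \<longlonglongrightarrow> ln Z" "(\<lambda>n. K / real n + ln Z) \<longlonglongrightarrow> ln Z"
      by (rule *)+
    show "\<forall>\<^sub>F n in sequentially. - K / real n + ln Z \<le> ln (P n) / real n"
      using eventually_gt_at_top[of 0]
    proof eventually_elim
      case (elim n)
      then have "- K / real n + ln Z = (- K + real n * ln Z) / real n"
        by (simp add: field_simps)
      also have "\<dots> \<le> ln (P n) / real n"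
        by (intro divide_right_mono bounds) simp
      finally show ?case .
    qed
    show "\<forall>\<^sub>F n in sequentially. ln (P n) / real n \<le> K / real n + ln Z"
      using eventually_gt_at_top[of 0]
    proof eventually_elim
      case (elim n)
      have "ln (P n) / real n \<le> (K + real n * ln Z) / real n"
        by (intro divide_right_mono bounds) simp
      also have "\<dots> = K / real n + ln Z"
        using elim by (simp add: field_simps)
      finally show ?case .
    qed
  qed
  then have "lim (\<lambda>n. ln (P n) / real n) = ln Z"
    by (rule limI)
  then show ?thesis
    by (simp add: geom_pressure_def pressure_def P_def f_def[abs_def] Z_def)
qed

definition gibbs_weights :: "nat \<Rightarrow> (nat \<Rightarrow> real) \<Rightarrow> real \<Rightarrow> nat \<Rightarrow> real" where
  "gibbs_weights d r u i = r i powr u / (\<Sum>j\<in>{1..d}. r j powr u)"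

lemma gibbs_weights_prob:
  assumes "\<And>i. i \<in> {1..d} \<Longrightarrow> 0 < r i" "d \<ge> 1"
  shows "i \<in> {1..d} \<Longrightarrow> 0 < gibbs_weights d r u i" "(\<Sum>i\<in>{1..d}. gibbs_weights d r u i) = 1"
proof -
  have Z: "0 < (\<Sum>j\<in>{1..d}. r j powr u)"
    by (rule sum_powr_pos[of d r, OF assms])
  show "0 < gibbs_weights d r u i" if "i \<in> {1..d}"
    using Z assms(1)[OF that] unfolding gibbs_weights_def by (intro divide_pos_pos) simp_all
  show "(\<Sum>i\<in>{1..d}. gibbs_weights d r u i) = 1"
    using Z by (simp add: gibbs_weights_def sum_divide_distrib[symmetric])
qed

text \<open>
  Up to a bounded factor \<open>K\<close> the Gibbs density equals the Bernoulli weight of the cylinder. So the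
  Bernoulli measure satisfies the Gibbs bounds, and every invariant measure with these bounds is
  comparable to it and hence equal to it.
\<close>

lemma invariant_gibbs_iff_bernoulli:
  assumes "CS d \<Phi>" "d \<ge> 2" and rates: "similarity_rates d \<Phi> r"
  shows "invariant_gibbs d \<Phi> u \<mu> \<longleftrightarrow> \<mu> = bernoulli d (gibbs_weights d r u)"
proof -
  let ?p = "gibbs_weights d r u" and ?Z = "\<Sum>j\<in>{1..d}. r j powr u"
  let ?S = "\<lambda>n x. birkhoff_sum n (geom_potential \<Phi>) x"
  have d: "d \<ge> 1"
    using assms(2) by simp
  note pos = similarity_rates_pos[OF rates]
  have p: "0 < ?p i" if "i \<in> {1..d}" for i
    by (intro gibbs_weights_prob pos d that)
  have p1: "(\<Sum>i\<in>{1..d}. ?p i) = 1"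
    by (intro gibbs_weights_prob pos d)
  have bernoulli: "prob_space (bernoulli d ?p)"
    "sets (bernoulli d ?p) = sets (stream_space (count_space {1..d}))"
    "distr (bernoulli d ?p) (bernoulli d ?p) stl = bernoulli d ?p"
    by (rule prob_space_bernoulli sets_bernoulli bernoulli_invariant p p1 | assumption)+
  have cylinder: "measure (bernoulli d ?p) (sstart {1..d} w) = weight ?p w" if "w \<in> words d n" for w n
    by (rule measure_bernoulli[OF _ p1 that]) (rule p)
  have Z: "0 < ?Z"
    by (intro sum_powr_pos pos d)
  obtain B where B: "B \<ge> 0" "\<And>n w x. w \<in> words d n \<Longrightarrow> x \<in> sstart {1..d} w \<Longrightarrow>
          \<bar>?S n x - ln (weight r w)\<bar> \<le> B"
    using potential_near_log_weight[OF assms] by blast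
  define g where "g n x = exp (u * ?S n x - real n * geom_pressure d \<Phi> u)" for n x
  define K where "K = exp (\<bar>u\<bar> * B)"
  have K: "1 \<le> K"
    using B(1) by (simp add: K_def)
  have g: "g n x \<le> K * weight ?p w" "weight ?p w \<le> K * g n x"
    if w: "w \<in> words d n" and x: "x \<in> sstart {1..d} w" for n w x
  proof -
    have weight: "weight ?p w = exp (u * ln (weight r w) - real n * ln ?Z)"
    proof -
      have "weight ?p w = weight r w powr u / ?Z ^ n"
        using weight_normalised[of d r w n u ?Z, OF pos w] by (simp add: gibbs_weights_def[abs_def])
      also have "?Z ^ n = exp (real n * ln ?Z)"
        using Z by (simp add: exp_of_nat_mult)
      finally show ?thesis
        using weight_pos[of d r, OF pos w] by (simp add: powr_def exp_diff)
    qed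
    have "\<bar>u * (?S n x - ln (weight r w))\<bar> \<le> \<bar>u\<bar> * B"
      unfolding abs_mult by (intro mult_left_mono B(2)[OF w x]) simp
    then have *: "u * ?S n x \<le> \<bar>u\<bar> * B + u * ln (weight r w)"
      "u * ln (weight r w) \<le> \<bar>u\<bar> * B + u * ?S n x"
      by (simp_all add: right_diff_distrib abs_le_iff)
    show "g n x \<le> K * weight ?p w" "weight ?p w \<le> K * g n x"
      unfolding g_def K_def weight geom_pressure_eq[OF assms] exp_add[symmetric]
      using * by simp_all
  qed
  have gpos: "0 < g n x" for n x
    by (simp add: g_def)
  show ?thesis
  proof
    assume "invariant_gibbs d \<Phi> u \<mu>"
    then obtain C where \<mu>: "prob_space \<mu>" "sets \<mu> = sets (stream_space (count_space {1..d}))"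
      "distr \<mu> \<mu> stl = \<mu>" and C: "C \<ge> 1"
      and le: "\<And>n w x. w \<in> words d n \<Longrightarrow> x \<in> sstart {1..d} w \<Longrightarrow> measure \<mu> (sstart {1..d} w) \<le> C * g n x"
      unfolding invariant_gibbs_def Let_def g_def by blast
    have bound: "measure \<mu> (sstart {1..d} w) \<le> C * K * weight ?p w" if w: "w \<in> words d n" for w n
    proof -
      obtain x where x: "x \<in> sstart {1..d} w"
        using sstart_nonempty[OF w d] by blast
      have "C * g n x \<le> C * (K * weight ?p w)"
        using C by (intro mult_left_mono g(1)[OF w x]) simp
      then show ?thesis
        using le[OF w x] by (simp add: mult.assoc)
    qed
    show "\<mu> = bernoulli d ?p"
    proof (rule measure_eq_on_cylinders[OF \<mu>(1,2) bernoulli(1,2)])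
      fix n w assume w: "w \<in> words d n"
      have "measure \<mu> (sstart {1..d} w) = weight ?p w"
        by (rule invariant_measure_eq_weight[OF _ p1 \<mu> bound w]) (rule p)
      then show "measure \<mu> (sstart {1..d} w) = measure (bernoulli d ?p) (sstart {1..d} w)"
        by (simp add: cylinder[OF w])
    qed
  next
    assume \<mu>: "\<mu> = bernoulli d ?p"
    have "g n x / K \<le> measure \<mu> (sstart {1..d} w) \<and> measure \<mu> (sstart {1..d} w) \<le> K * g n x"
      if "w \<in> words d n" "x \<in> sstart {1..d} w" for n w x
      using g[OF that] cylinder[OF that(1)] K
      by (simp add: \<mu> pos_divide_le_eq mult.commute)
    then have "\<exists>C\<ge>1. \<forall>n. \<forall>w\<in>words d n. \<forall>x\<in>sstart {1..d} w.
        g n x / C \<le> measure \<mu> (sstart {1..d} w) \<and> measure \<mu> (sstart {1..d} w) \<le> C * g n x"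
      using K by blast
    then show "invariant_gibbs d \<Phi> u \<mu>"
      unfolding invariant_gibbs_def Let_def g_def[symmetric]
      using bernoulli by (simp add: \<mu>)
  qed
qed

lemma gibbs_measure_eq_bernoulli:
  assumes "CS d \<Phi>" "d \<ge> 2" "similarity_rates d \<Phi> r"
  shows "gibbs_measure d \<Phi> u = bernoulli d (gibbs_weights d r u)"
  unfolding gibbs_measure_def invariant_gibbs_iff_bernoulli[OF assms] by simp

lemma bernoulli_eq_iff:
  assumes p: "\<And>i. i \<in> {1..d} \<Longrightarrow> 0 < p i" "(\<Sum>i\<in>{1..d}. p i) = 1"
    and q: "\<And>i. i \<in> {1..d} \<Longrightarrow> 0 < q i" "(\<Sum>i\<in>{1..d}. q i) = 1"
  shows "bernoulli d p = bernoulli d q \<longleftrightarrow> (\<forall>i\<in>{1..d}. p i = q i)"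
proof
  assume eq: "bernoulli d p = bernoulli d q"
  show "\<forall>i\<in>{1..d}. p i = q i"
  proof
    fix i assume "i \<in> {1..d}"
    then have "[i] \<in> words d 1"
      by (simp add: words_def)
    have "measure (bernoulli d p) (sstart {1..d} [i]) = weight p [i]"
      by (rule measure_bernoulli[OF p \<open>[i] \<in> words d 1\<close>])
    moreover have "measure (bernoulli d q) (sstart {1..d} [i]) = weight q [i]"
      by (rule measure_bernoulli[OF q \<open>[i] \<in> words d 1\<close>])
    ultimately show "p i = q i"
      by (simp add: eq)
  qed
next
  assume eq: "\<forall>i\<in>{1..d}. p i = q i"
  show "bernoulli d p = bernoulli d q"
  proof (rule measure_eq_on_cylinders)
    show "measure (bernoulli d p) (sstart {1..d} w) = measure (bernoulli d q) (sstart {1..d} w)"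
      if w: "w \<in> words d n" for n w
    proof -
      have "measure (bernoulli d p) (sstart {1..d} w) = weight p w"
        by (rule measure_bernoulli[OF p w])
      also have "\<dots> = weight q w"
        using eq w by (intro weight_cong) auto
      also have "\<dots> = measure (bernoulli d q) (sstart {1..d} w)"
        by (rule measure_bernoulli[OF q w, symmetric])
      finally show ?thesis .
    qed
  qed (rule prob_space_bernoulli sets_bernoulli p q | assumption)+
qed

text \<open>
  Permuting the generators of \<open>\<Psi>\<close> permutes its rates, so that both sides become Bernoulli measures,
  which are equal exactly when their one-letter weights are.
\<close>

lemma gibbs_cong_iff:
  assumes "CS d \<Phi>" "CS d \<Psi>" "d \<ge> 2" and r: "similarity_rates d \<Phi> r" and \<rho>: "similarity_rates d \<Psi> \<rho>"
  shows "gibbs_cong d \<Phi> u \<Psi> v \<longleftrightarrow> (\<exists>\<tau>. \<tau> permutes {1..d} \<and>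
      (\<forall>i\<in>{1..d}. gibbs_weights d r u i = gibbs_weights d (\<lambda>j. \<rho> (\<tau> j)) v i))"
proof -
  have d: "d \<ge> 1"
    using assms(3) by simp
  have "gibbs_measure d \<Phi> u = gibbs_measure d (permute_gens \<tau> \<Psi>) v
      \<longleftrightarrow> (\<forall>i\<in>{1..d}. gibbs_weights d r u i = gibbs_weights d (\<lambda>j. \<rho> (\<tau> j)) v i)"
    if \<tau>: "\<tau> permutes {1..d}" for \<tau>
  proof -
    have \<rho>\<tau>: "similarity_rates d (permute_gens \<tau> \<Psi>) (\<lambda>j. \<rho> (\<tau> j))"
      by (rule similarity_rates_permute_gens[OF assms(2) \<tau> \<rho>])
    show ?thesis
      unfolding gibbs_measure_eq_bernoulli[OF assms(1,3) r]
        gibbs_measure_eq_bernoulli[OF CS_permute_gens[OF assms(2) \<tau>] assms(3) \<rho>\<tau>]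
      by (intro bernoulli_eq_iff gibbs_weights_prob similarity_rates_pos[OF r]
          similarity_rates_pos[OF \<rho>\<tau>] d)
  qed
  then show ?thesis
    unfolding gibbs_cong_def by blast
qed


section \<open>Equivalence classes of essentially affine systems\<close>

lemma AS_imp_EAS:
  assumes "AS d \<Phi>"
  shows "EAS d \<Phi>"
proof -
  have "gen \<Phi> i y = gen \<Phi> i (inv_into (limit_set d \<Phi>) (\<lambda>x. x) y)" if "y \<in> limit_set d \<Phi>" for i y
    using inv_into_f_f[of "\<lambda>x. x" "limit_set d \<Phi>" y] that by simp
  then show ?thesis
    unfolding EAS_def using assms bi_lipschitz_bij_id[of "limit_set d \<Phi>"]
    by (intro conjI exI[of _ \<Phi>] exI[of _ "\<lambda>x. x"]) (simp_all add: AS_def)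
qed

lemma EAS_imp_CS: "EAS d \<Phi> \<Longrightarrow> CS d \<Phi>"
  by (simp add: EAS_def)

lemma sim_sym: "CS d \<Phi> \<Longrightarrow> sim d \<Phi> \<Psi> \<Longrightarrow> sim d \<Psi> \<Phi>"
  unfolding sim_iff_conjugates using conjugates_inv by metis

lemma EAS_sim_AS:
  assumes "EAS d \<Psi>"
  obtains \<Phi> where "AS d \<Phi>" "sim d \<Psi> \<Phi>"
proof -
  obtain \<Phi> h where AS: "AS d \<Phi>" and h: "bi_lipschitz_bij h (limit_set d \<Phi>) (limit_set d \<Psi>)"
    and eq: "\<And>i y. i \<in> {1..d} \<Longrightarrow> y \<in> limit_set d \<Psi> \<Longrightarrow>
           gen \<Psi> i y = h (gen \<Phi> i (inv_into (limit_set d \<Phi>) h y))"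
    using assms unfolding EAS_def by blast
  have bij: "bij_betw h (limit_set d \<Phi>) (limit_set d \<Psi>)"
    using h by (simp add: bi_lipschitz_bij_def)
  have "conjugates d id h \<Phi> \<Psi>"
    unfolding conjugates_def
  proof (intro conjI ballI)
    fix i x assume i: "i \<in> {1..d}" and x: "x \<in> limit_set d \<Phi>"
    have "h x \<in> limit_set d \<Psi>"
      using bij_betwE[OF bij] x by blast
    from eq[OF i this] show "gen \<Psi> (id i) (h x) = h (gen \<Phi> i x)"
      using bij_betw_inv_into_left[OF bij x] by simp
  qed (simp_all add: h permutes_id)
  then have "sim d \<Phi> \<Psi>"
    unfolding sim_iff_conjugates by blast
  then have "sim d \<Psi> \<Phi>"
    using sim_sym AS by (simp add: AS_def)
  with AS show ?thesis
    by (rule that)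
qed

lemma equiv_sim: "equiv {\<Phi>. EAS d \<Phi>} {(\<Phi>, \<Psi>). EAS d \<Phi> \<and> EAS d \<Psi> \<and> sim d \<Phi> \<Psi>}"
proof (rule equivI)
  show "refl_on {\<Phi>. EAS d \<Phi>} {(\<Phi>, \<Psi>). EAS d \<Phi> \<and> EAS d \<Psi> \<and> sim d \<Phi> \<Psi>}"
    using conjugates_refl by (auto simp: refl_on_def sim_iff_conjugates)
  show "sym {(\<Phi>, \<Psi>). EAS d \<Phi> \<and> EAS d \<Psi> \<and> sim d \<Phi> \<Psi>}"
    using sim_sym EAS_imp_CS by (auto simp: sym_def)
  show "trans {(\<Phi>, \<Psi>). EAS d \<Phi> \<and> EAS d \<Psi> \<and> sim d \<Phi> \<Psi>}"
  proof (rule transI, clarsimp)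
    fix \<Phi> \<Psi> \<Omega> assume "sim d \<Phi> \<Psi>" "sim d \<Psi> \<Omega>"
    then obtain \<tau> h \<upsilon> k where "conjugates d \<tau> h \<Phi> \<Psi>" "conjugates d \<upsilon> k \<Psi> \<Omega>"
      unfolding sim_iff_conjugates by blast
    from conjugates_comp[OF this] show "sim d \<Phi> \<Omega>"
      unfolding sim_iff_conjugates by blast
  qed
qed auto

lemma moduli_E_D:
  assumes "A \<in> moduli_E d"
  shows "\<Phi> \<in> A \<Longrightarrow> EAS d \<Phi>"
    and "\<Phi> \<in> A \<Longrightarrow> \<Psi> \<in> A \<Longrightarrow> sim d \<Phi> \<Psi>"
    and "\<Phi> \<in> A \<Longrightarrow> EAS d \<Psi> \<Longrightarrow> sim d \<Phi> \<Psi> \<Longrightarrow> \<Psi> \<in> A"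
    and "A \<noteq> {}"
proof -
  note A = assms[unfolded moduli_E_def]
  show EAS: "EAS d \<Phi>" if "\<Phi> \<in> A" for \<Phi>
    using in_quotient_imp_subset[OF equiv_sim A] that by blast
  show "sim d \<Phi> \<Psi>" if "\<Phi> \<in> A" "\<Psi> \<in> A"
    using in_quotient_imp_in_rel[OF equiv_sim A, of \<Phi> \<Psi>] that by simp
  show "\<Psi> \<in> A" if "\<Phi> \<in> A" "EAS d \<Psi>" "sim d \<Phi> \<Psi>"
    using in_quotient_imp_closed[OF equiv_sim A that(1), of \<Psi>] EAS[OF that(1)] that by simp
  show "A \<noteq> {}"
    by (rule in_quotient_imp_non_empty[OF equiv_sim A])
qed

lemma contraction_rates_iff: "contraction_rates d A r \<longleftrightarrow> (\<exists>\<Phi>\<in>A. slope_sizes d \<Phi> r)"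
  by (simp add: contraction_rates_def slope_sizes_def)

lemma contraction_rates_exist:
  assumes "A \<in> moduli_E d" "d \<ge> 2"
  obtains r where "contraction_rates d A r"
proof -
  obtain \<Psi> where \<Psi>: "\<Psi> \<in> A"
    using moduli_E_D(4)[OF assms(1)] by blast
  obtain \<Phi> where \<Phi>: "AS d \<Phi>" "sim d \<Psi> \<Phi>"
    using EAS_sim_AS[OF moduli_E_D(1)[OF assms(1) \<Psi>]] .
  have "\<Phi> \<in> A"
    by (rule moduli_E_D(3)[OF assms(1) \<Psi> AS_imp_EAS[OF \<Phi>(1)] \<Phi>(2)])
  moreover obtain r where "slope_sizes d \<Phi> r"
    using slope_sizes_exist[OF \<Phi>(1) assms(2)] .
  ultimately show ?thesis
    using that by (auto simp: contraction_rates_iff)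
qed

lemma contraction_rates_bounds:
  assumes "contraction_rates d A r" "d \<ge> 2"
  shows "i \<in> {1..d} \<Longrightarrow> 0 < r i" "(\<Sum>i\<in>{1..d}. r i) \<le> 1"
proof -
  obtain \<Phi> where \<Phi>: "slope_sizes d \<Phi> r"
    using assms(1) by (auto simp: contraction_rates_iff)
  show "0 < r i" if "i \<in> {1..d}"
    by (rule slope_sizes_D(1)[OF \<Phi> assms(2) that])
  show "(\<Sum>i\<in>{1..d}. r i) \<le> 1"
    by (rule slope_sizes_sum_le_1[OF \<Phi> assms(2)])
qed

text \<open>
  Any member of the class, affine or not, is conjugate to the affine member whose rates are \<open>r\<close>; the
  conjugacy may reorder the generators.
\<close>

lemma contraction_rates_similarity:
  assumes "A \<in> moduli_E d" "d \<ge> 2" "contraction_rates d A r" "\<Phi> \<in> A"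
  obtains \<tau> where "\<tau> permutes {1..d}" "similarity_rates d \<Phi> (\<lambda>i. r (\<tau> i))"
proof -
  obtain \<Psi> where \<Psi>: "\<Psi> \<in> A" "slope_sizes d \<Psi> r"
    using assms(3) by (auto simp: contraction_rates_iff)
  obtain \<tau> h where conj: "conjugates d \<tau> h \<Phi> \<Psi>"
    using moduli_E_D(2)[OF assms(1,4) \<Psi>(1)] unfolding sim_iff_conjugates by blast
  show ?thesis
    by (rule that[OF conjugates_D(1)[OF conj]
          similarity_rates_transport[OF EAS_imp_CS[OF moduli_E_D(1)[OF assms(1,4)]] conj
            slope_sizes_similarity[OF \<Psi>(2) assms(2)]]])
qed

lemma contraction_rates_permute:
  assumes "A \<in> moduli_E d" "contraction_rates d A r" and \<tau>: "\<tau> permutes {1..d}"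
  shows "contraction_rates d A (\<lambda>i. r (\<tau> i))"
proof -
  obtain \<Phi> where \<Phi>: "\<Phi> \<in> A" "slope_sizes d \<Phi> r"
    using assms(2) by (auto simp: contraction_rates_iff)
  have perm: "slope_sizes d (permute_gens \<tau> \<Phi>) (\<lambda>i. r (\<tau> i))"
    by (rule slope_sizes_permute_gens[OF \<Phi>(2) \<tau>])
  then have AS: "AS d (permute_gens \<tau> \<Phi>)"
    by (simp add: slope_sizes_def)
  have "sim d (permute_gens \<tau> \<Phi>) \<Phi>"
    unfolding sim_iff_conjugates using conjugates_permute_gens[OF \<tau>] by blast
  then have "sim d \<Phi> (permute_gens \<tau> \<Phi>)"
    using sim_sym AS by (simp add: AS_def)
  from moduli_E_D(3)[OF assms(1) \<Phi>(1) AS_imp_EAS[OF AS] this] perm show ?thesis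
    unfolding contraction_rates_iff by blast
qed


section \<open>The Lyapunov relation in terms of contraction rates\<close>

lemma powr_proportional:
  fixes u v c x y :: real
  assumes "0 < x" "0 < y" "0 < c" "v \<noteq> 0" "y powr v = c * x powr u"
  shows "y = c powr (1 / v) * x powr (u / v)"
proof -
  have "y = (y powr v) powr (1 / v)"
    using assms(2,4) by (simp add: powr_powr)
  also have "\<dots> = c powr (1 / v) * x powr (u / v)"
    using assms(1,3) by (simp add: assms(5) powr_mult powr_powr)
  finally show ?thesis .
qed

text \<open>
  Comparing Bernoulli weights gives \<open>\<rho>\<^sub>i powr v = (Z' / Z) * r\<^sub>i powr u\<close> for normalising constants \<open>Z\<close> and
  \<open>Z'\<close>, whence \<open>s = u / v\<close> and \<open>t = (Z' / Z) powr (1 / v)\<close>. Conversely, rates \<open>\<rho>\<^sub>i = t * r\<^sub>i powr s\<close> yield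
  the same weights at \<open>v = 1\<close> as \<open>r\<close> does at \<open>u = s\<close>, since the factor \<open>t\<close> cancels.
\<close>

lemma lyapunov_rel_iff_rates:
  assumes A: "A \<in> moduli_E d" and B: "B \<in> moduli_E d" and d: "d \<ge> 2"
    and r: "contraction_rates d A r"
  shows "(A, B) \<in> lyapunov_rel d \<longleftrightarrow>
    (\<exists>\<rho> s t. contraction_rates d B \<rho> \<and> s \<noteq> 0 \<and> t > 0 \<and> (\<forall>i\<in>{1..d}. \<rho> i = t * r i powr s))"
proof
  assume "(A, B) \<in> lyapunov_rel d"
  then obtain \<Phi> \<Psi> u v where \<Phi>: "\<Phi> \<in> A" and \<Psi>: "\<Psi> \<in> B" and uv: "u \<noteq> 0" "v \<noteq> 0"
    and cong: "gibbs_cong d \<Phi> u \<Psi> v"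
    unfolding lyapunov_rel_def by blast
  obtain \<rho>0 where \<rho>0: "contraction_rates d B \<rho>0"
    using contraction_rates_exist[OF B d] .
  obtain \<sigma> where \<sigma>: "\<sigma> permutes {1..d}" "similarity_rates d \<Phi> (\<lambda>i. r (\<sigma> i))"
    using contraction_rates_similarity[OF A d r \<Phi>] .
  obtain \<sigma>' where \<sigma>': "\<sigma>' permutes {1..d}" "similarity_rates d \<Psi> (\<lambda>i. \<rho>0 (\<sigma>' i))"
    using contraction_rates_similarity[OF B d \<rho>0 \<Psi>] .
  obtain \<tau> where \<tau>: "\<tau> permutes {1..d}" and eq: "\<And>i. i \<in> {1..d} \<Longrightarrow>
      gibbs_weights d (\<lambda>i. r (\<sigma> i)) u i = gibbs_weights d (\<lambda>i. \<rho>0 (\<sigma>' (\<tau> i))) v i"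
    using cong gibbs_cong_iff[OF EAS_imp_CS[OF moduli_E_D(1)[OF A \<Phi>]]
        EAS_imp_CS[OF moduli_E_D(1)[OF B \<Psi>]] d \<sigma>(2) \<sigma>'(2)] by blast
  \<comment> \<open>The representatives and the given rate vectors are ordered in three different ways; \<open>\<kappa>\<close> combines
    the three reorderings into one of \<open>\<rho>0\<close> that matches \<open>r\<close>.\<close>
  define \<kappa> where "\<kappa> = \<sigma>' \<circ> (\<tau> \<circ> inv \<sigma>)"
  have \<kappa>: "\<kappa> permutes {1..d}"
    unfolding \<kappa>_def by (intro permutes_compose permutes_inv \<sigma> \<sigma>' \<tau>)
  define \<rho> where "\<rho> i = \<rho>0 (\<kappa> i)" for i
  have \<rho>: "contraction_rates d B \<rho>"
    unfolding \<rho>_def[abs_def] by (rule contraction_rates_permute[OF B \<rho>0 \<kappa>])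
  define Z where "Z = (\<Sum>j\<in>{1..d}. r (\<sigma> j) powr u)"
  define Z' where "Z' = (\<Sum>j\<in>{1..d}. \<rho>0 (\<sigma>' (\<tau> j)) powr v)"
  have in_I: "\<pi> i \<in> {1..d}" if "\<pi> permutes {1..d}" "i \<in> {1..d}" for \<pi> :: "nat \<Rightarrow> nat" and i
    using permutes_in_image[OF that(1)] that(2) by blast
  have "1 \<le> d"
    using d by simp
  have "0 < r (\<sigma> i)" if "i \<in> {1..d}" for i
    by (rule contraction_rates_bounds(1)[OF r d in_I[OF \<sigma>(1) that]])
  then have "0 < Z"
    unfolding Z_def using \<open>1 \<le> d\<close> by (rule sum_powr_pos)
  have "0 < \<rho>0 (\<sigma>' (\<tau> i))" if "i \<in> {1..d}" for i
    by (rule contraction_rates_bounds(1)[OF \<rho>0 d in_I[OF \<sigma>'(1) in_I[OF \<tau> that]]])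
  then have "0 < Z'"
    unfolding Z'_def using \<open>1 \<le> d\<close> by (rule sum_powr_pos)
  note Z = \<open>0 < Z\<close> \<open>0 < Z'\<close>
  have "\<rho> j = (Z' / Z) powr (1 / v) * r j powr (u / v)" if j: "j \<in> {1..d}" for j
  proof (rule powr_proportional)
    have "inv \<sigma> j \<in> {1..d}"
      by (rule in_I[OF permutes_inv[OF \<sigma>(1)] j])
    from eq[OF this] have "r j powr u / Z = \<rho> j powr v / Z'"
      by (simp add: gibbs_weights_def Z_def Z'_def \<rho>_def \<kappa>_def permutes_inverses(1)[OF \<sigma>(1)])
    then show "\<rho> j powr v = Z' / Z * r j powr u"
      using Z by (simp add: field_simps)
  qed (use Z uv contraction_rates_bounds(1)[OF r d j] contraction_rates_bounds(1)[OF \<rho> d j] in auto)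
  moreover have "u / v \<noteq> 0" "0 < (Z' / Z) powr (1 / v)"
    using uv Z by simp_all
  ultimately show "\<exists>\<rho> s t. contraction_rates d B \<rho> \<and> s \<noteq> 0 \<and> t > 0 \<and> (\<forall>i\<in>{1..d}. \<rho> i = t * r i powr s)"
    using \<rho> by blast
next
  assume "\<exists>\<rho> s t. contraction_rates d B \<rho> \<and> s \<noteq> 0 \<and> t > 0 \<and> (\<forall>i\<in>{1..d}. \<rho> i = t * r i powr s)"
  then obtain \<rho> s t where \<rho>: "contraction_rates d B \<rho>" and s: "s \<noteq> 0" and t: "t > 0"
    and eq: "\<And>i. i \<in> {1..d} \<Longrightarrow> \<rho> i = t * r i powr s"
    by blast
  obtain \<Phi> where \<Phi>: "\<Phi> \<in> A" "slope_sizes d \<Phi> r"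
    using r by (auto simp: contraction_rates_iff)
  obtain \<Psi> where \<Psi>: "\<Psi> \<in> B" "slope_sizes d \<Psi> \<rho>"
    using \<rho> by (auto simp: contraction_rates_iff)
  have "gibbs_weights d r s i = gibbs_weights d \<rho> 1 i" if i: "i \<in> {1..d}" for i
  proof -
    have powr_1: "\<rho> j powr 1 = t * r j powr s" if "j \<in> {1..d}" for j
      using contraction_rates_bounds(1)[OF \<rho> d that] eq[OF that] by simp
    have "(\<Sum>j\<in>{1..d}. \<rho> j powr 1) = (\<Sum>j\<in>{1..d}. t * r j powr s)"
      by (intro sum.cong refl powr_1)
    then show ?thesis
      using t by (simp add: gibbs_weights_def powr_1[OF i] sum_distrib_left[symmetric] del: powr_one')
  qed
  then have "gibbs_cong d \<Phi> s \<Psi> 1"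
    unfolding gibbs_cong_iff[OF EAS_imp_CS[OF moduli_E_D(1)[OF A \<Phi>(1)]]
        EAS_imp_CS[OF moduli_E_D(1)[OF B \<Psi>(1)]] d
        slope_sizes_similarity[OF \<Phi>(2) d] slope_sizes_similarity[OF \<Psi>(2) d]]
    by (intro exI[of _ id]) (simp add: permutes_id)
  moreover have "(1::real) \<noteq> 0"
    by simp
  ultimately show "(A, B) \<in> lyapunov_rel d"
    unfolding lyapunov_rel_def using A B \<Phi>(1) \<Psi>(1) s by blast
qed

text \<open>
  The maps \<open>x \<mapsto> t * x powr s\<close> with \<open>t > 0\<close> and \<open>s \<noteq> 0\<close> form a group of transformations of the positive reals.
\<close>

lemma equiv_lyapunov_rel:
  assumes d: "d \<ge> 2"
  shows "equiv (moduli_E d) (lyapunov_rel d)"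
proof (rule equivI)
  show sub: "lyapunov_rel d \<subseteq> moduli_E d \<times> moduli_E d"
    by (auto simp: lyapunov_rel_def)
  show "refl_on (moduli_E d) (lyapunov_rel d)"
  proof (rule refl_onI)
    fix A assume A: "A \<in> moduli_E d"
    obtain r where r: "contraction_rates d A r"
      using contraction_rates_exist[OF A d] .
    have "r i = 1 * r i powr 1" if "i \<in> {1..d}" for i
      using contraction_rates_bounds(1)[OF r d that] by simp
    then show "(A, A) \<in> lyapunov_rel d"
      unfolding lyapunov_rel_iff_rates[OF A A d r]
      using r by (intro exI[of _ r] exI[of _ "1::real"]) simp
  qed
  show "sym (lyapunov_rel d)"
  proof (rule symI)
    fix A B assume AB: "(A, B) \<in> lyapunov_rel d"
    then have A: "A \<in> moduli_E d" and B: "B \<in> moduli_E d"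
      using sub by auto
    obtain r where r: "contraction_rates d A r"
      using contraction_rates_exist[OF A d] .
    obtain \<rho> s t where \<rho>: "contraction_rates d B \<rho>" and s: "s \<noteq> 0" and t: "t > 0"
      and eq: "\<And>i. i \<in> {1..d} \<Longrightarrow> \<rho> i = t * r i powr s"
      using AB unfolding lyapunov_rel_iff_rates[OF A B d r] by blast
    have "r i = (1 / t) powr (1 / s) * \<rho> i powr (1 / s)" if i: "i \<in> {1..d}" for i
    proof (rule powr_proportional)
      show "0 < \<rho> i" "0 < r i"
        using contraction_rates_bounds(1)[OF r d i] contraction_rates_bounds(1)[OF \<rho> d i] by simp_all
      then show "r i powr s = 1 / t * \<rho> i powr 1"
        using t by (simp add: eq[OF i])
    qed (use s t in auto)
    moreover have "1 / s \<noteq> 0" "0 < (1 / t) powr (1 / s)"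
      using s t by simp_all
    ultimately show "(B, A) \<in> lyapunov_rel d"
      unfolding lyapunov_rel_iff_rates[OF B A d \<rho>] using r by blast
  qed
  show "trans (lyapunov_rel d)"
  proof (rule transI)
    fix A B C assume AB: "(A, B) \<in> lyapunov_rel d" and BC: "(B, C) \<in> lyapunov_rel d"
    then have A: "A \<in> moduli_E d" and B: "B \<in> moduli_E d" and C: "C \<in> moduli_E d"
      using sub by auto
    obtain r where r: "contraction_rates d A r"
      using contraction_rates_exist[OF A d] .
    obtain \<rho> s t where \<rho>: "contraction_rates d B \<rho>" and s: "s \<noteq> 0" and t: "t > 0"
      and eq: "\<And>i. i \<in> {1..d} \<Longrightarrow> \<rho> i = t * r i powr s"
      using AB unfolding lyapunov_rel_iff_rates[OF A B d r] by blast
    obtain \<theta> s' t' where \<theta>: "contraction_rates d C \<theta>" and s': "s' \<noteq> 0" and t': "t' > 0"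
      and eq': "\<And>i. i \<in> {1..d} \<Longrightarrow> \<theta> i = t' * \<rho> i powr s'"
      using BC unfolding lyapunov_rel_iff_rates[OF B C d \<rho>] by blast
    have "\<theta> i = (t' * t powr s') * r i powr (s * s')" if i: "i \<in> {1..d}" for i
      using contraction_rates_bounds(1)[OF r d i] t by (simp add: eq[OF i] eq'[OF i] powr_mult powr_powr)
    moreover have "s * s' \<noteq> 0" "0 < t' * t powr s'"
      using s s' t t' by simp_all
    ultimately show "(A, C) \<in> lyapunov_rel d"
      unfolding lyapunov_rel_iff_rates[OF A C d r] using \<theta> by blast
  qed
qed

text \<open>
  The affine system with equal derivatives that witnesses degeneracy belongs to the class itself.
\<close>

lemma degenerate_class_constant_rates:
  assumes A: "A \<in> moduli_E d" and d: "d \<ge> 2" and "degenerate_class d A"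
  obtains r c where "contraction_rates d A r" "0 < c" "\<And>i. i \<in> {1..d} \<Longrightarrow> r i = c"
proof -
  obtain \<Phi> \<Psi> where \<Phi>: "\<Phi> \<in> A" and \<Psi>: "AS d \<Psi>" "sim d \<Phi> \<Psi>"
    and eq: "\<forall>i\<in>{1..d}. \<forall>j\<in>{1..d}. \<forall>x\<in>interior (base \<Psi>). deriv (gen \<Psi> i) x = deriv (gen \<Psi> j) x"
    using assms(3) unfolding degenerate_class_def degenerate_def by blast
  have "\<Psi> \<in> A"
    by (rule moduli_E_D(3)[OF A \<Phi> AS_imp_EAS[OF \<Psi>(1)] \<Psi>(2)])
  moreover obtain r where r: "slope_sizes d \<Psi> r"
    using slope_sizes_exist[OF \<Psi>(1) d] .
  ultimately have rates: "contraction_rates d A r"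
    unfolding contraction_rates_iff by blast
  obtain x where x: "x \<in> interior (base \<Psi>)"
    using AS_interior_nonempty[OF \<Psi>(1) d] by blast
  have 1: "1 \<in> {1..d}"
    using d by simp
  have "r i = r 1" if i: "i \<in> {1..d}" for i
  proof -
    have "r i = \<bar>deriv (gen \<Psi> i) x\<bar>" "r 1 = \<bar>deriv (gen \<Psi> 1) x\<bar>"
      using r i 1 x unfolding slope_sizes_def by blast+
    moreover have "deriv (gen \<Psi> i) x = deriv (gen \<Psi> 1) x"
      using eq i 1 x by blast
    ultimately show ?thesis
      by simp
  qed
  then show ?thesis
    by (rule that[OF rates contraction_rates_bounds(1)[OF rates d 1]])
qed

theorem proposition4p10:
  fixes d :: nat
  assumes "d \<ge> 2"
  shows "equiv (moduli_E d) (lyapunov_rel d) \<and>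
    (\<forall>A\<in>moduli_E d.
       (degenerate_class d A \<longrightarrow>
          lyapunov_rel d `` {A} =
            {B \<in> moduli_E d. \<exists>\<rho>. contraction_rates d B \<rho> \<and>
               (\<exists>t. 0 < t \<and> t \<le> 1 / real d \<and> (\<forall>i\<in>{1..d}. \<rho> i = t))}) \<and>
       (\<not> degenerate_class d A \<longrightarrow>
          (\<forall>r. contraction_rates d A r \<longrightarrow>
             lyapunov_rel d `` {A} =
               {B \<in> moduli_E d. \<exists>\<rho>. contraction_rates d B \<rho> \<and>
                  (\<exists>s t. s \<noteq> 0 \<and> t \<noteq> 0 \<and> (\<forall>i\<in>{1..d}. \<rho> i = t * (r i powr s)))})))"
proof (intro conjI ballI impI allI)
  note d = assms
  have 1: "1 \<in> {1..d}"
    using d by simp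
  show "equiv (moduli_E d) (lyapunov_rel d)"
    by (rule equiv_lyapunov_rel[OF d])
  fix A assume A: "A \<in> moduli_E d"
  have image: "lyapunov_rel d `` {A} = {B \<in> moduli_E d. (A, B) \<in> lyapunov_rel d}"
    by (auto simp: lyapunov_rel_def)
  show "lyapunov_rel d `` {A} =
            {B \<in> moduli_E d. \<exists>\<rho>. contraction_rates d B \<rho> \<and>
               (\<exists>t. 0 < t \<and> t \<le> 1 / real d \<and> (\<forall>i\<in>{1..d}. \<rho> i = t))}"
    if "degenerate_class d A"
  proof -
    obtain r c where r: "contraction_rates d A r" and c: "0 < c" "\<And>i. i \<in> {1..d} \<Longrightarrow> r i = c"
      using degenerate_class_constant_rates[OF A d \<open>degenerate_class d A\<close>] by blast
    have "(A, B) \<in> lyapunov_rel d \<longleftrightarrow> (\<exists>\<rho>. contraction_rates d B \<rho> \<and>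
               (\<exists>t. 0 < t \<and> t \<le> 1 / real d \<and> (\<forall>i\<in>{1..d}. \<rho> i = t)))"
      if B: "B \<in> moduli_E d" for B
      unfolding lyapunov_rel_iff_rates[OF A B d r]
    proof
      assume "\<exists>\<rho> s t. contraction_rates d B \<rho> \<and> s \<noteq> 0 \<and> t > 0 \<and> (\<forall>i\<in>{1..d}. \<rho> i = t * r i powr s)"
      then obtain \<rho> s t where \<rho>: "contraction_rates d B \<rho>" and t: "t > 0"
        and eq: "\<And>i. i \<in> {1..d} \<Longrightarrow> \<rho> i = t * r i powr s"
        by blast
      let ?t = "t * c powr s"
      have const: "\<rho> i = ?t" if "i \<in> {1..d}" for i
        using eq[OF that] c(2)[OF that] by simp
      have "(\<Sum>i\<in>{1..d}. \<rho> i) = (\<Sum>i\<in>{1..d}. ?t)"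
        by (intro sum.cong refl const)
      also have "\<dots> = real d * ?t"
        by simp
      finally have "real d * ?t \<le> 1"
        using contraction_rates_bounds(2)[OF \<rho> d] by simp
      then have "?t \<le> 1 / real d"
        using d by (simp add: field_simps)
      moreover have "0 < ?t"
        using t c(1) by simp
      ultimately show "\<exists>\<rho>. contraction_rates d B \<rho> \<and>
               (\<exists>t. 0 < t \<and> t \<le> 1 / real d \<and> (\<forall>i\<in>{1..d}. \<rho> i = t))"
        using \<rho> const by blast
    next
      assume "\<exists>\<rho>. contraction_rates d B \<rho> \<and>
               (\<exists>t. 0 < t \<and> t \<le> 1 / real d \<and> (\<forall>i\<in>{1..d}. \<rho> i = t))"
      then obtain \<rho> t where \<rho>: "contraction_rates d B \<rho>" and t: "0 < t" "\<And>i. i \<in> {1..d} \<Longrightarrow> \<rho> i = t"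
        by blast
      have "\<forall>i\<in>{1..d}. \<rho> i = t / c * r i powr 1"
        using t c by simp
      moreover have "(1::real) \<noteq> 0" "0 < t / c"
        using t c by simp_all
      ultimately show "\<exists>\<rho> s t. contraction_rates d B \<rho> \<and> s \<noteq> 0 \<and> t > 0 \<and> (\<forall>i\<in>{1..d}. \<rho> i = t * r i powr s)"
        using \<rho> by blast
    qed
    then show ?thesis
      unfolding image by (intro Collect_cong conj_cong refl)
  qed
  show "lyapunov_rel d `` {A} =
               {B \<in> moduli_E d. \<exists>\<rho>. contraction_rates d B \<rho> \<and>
                  (\<exists>s t. s \<noteq> 0 \<and> t \<noteq> 0 \<and> (\<forall>i\<in>{1..d}. \<rho> i = t * (r i powr s)))}"
    if "\<not> degenerate_class d A" and r: "contraction_rates d A r" for r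
  proof -
    have "(A, B) \<in> lyapunov_rel d \<longleftrightarrow> (\<exists>\<rho>. contraction_rates d B \<rho> \<and>
                  (\<exists>s t. s \<noteq> 0 \<and> t \<noteq> 0 \<and> (\<forall>i\<in>{1..d}. \<rho> i = t * (r i powr s))))"
      if B: "B \<in> moduli_E d" for B
    proof -
      have "t > 0 \<longleftrightarrow> t \<noteq> 0" if \<rho>: "contraction_rates d B \<rho>"
        and eq: "\<forall>i\<in>{1..d}. \<rho> i = t * r i powr s" for \<rho> s t
      proof -
        \<comment> \<open>Rates are positive, so a nonzero factor is a positive one.\<close>
        have "0 < t * r 1 powr s"
          using contraction_rates_bounds(1)[OF \<rho> d 1] eq 1 by metis
        then show ?thesis
          by (auto simp: zero_less_mult_iff)
      qed
      then show ?thesis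
        unfolding lyapunov_rel_iff_rates[OF A B d r] by metis
    qed
    then show ?thesis
      unfolding image by (intro Collect_cong conj_cong refl)
  qed
qed

end
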